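(* Let $H\ge1$ be a fixed integer and let $(p_n)$ be an arbitrary sequence of positive integers with $p_n\to+\infty$. Let $\mathbf{X}_{nt}$, $t=1,\ldots,n$, $n=1,2,\ldots$, be a triangular array such that, for each $n$, the random $p_n$-vectors $\mathbf{X}_{n1},\ldots,\mathbf{X}_{nn}$ are i.i.d. with a common distribution that has spherical directions. Let $\mathbf{U}_{nt}=\mathbf{X}_{nt}/\|\mathbf{X}_{nt}\|$, and $$T_n=\sum_{h=1}^H (n-h)\|\mathbf{r}(h)\|_{\rm Fr}^2,\qquad \mathbf{r}(h)=\frac{p_n}{n-h}\sum_{t=h+1}^n\mathbf{U}_{nt}\mathbf{U}_{n,t-h}'.$$ Then $$T_n^{\rm St}=\frac{T_n-Hp_n^2}{\sqrt{2Hp_n^2}}=\frac{\sqrt{2p_n^2}}{\sqrt H}\sum_{h=1}^H\frac{1}{n-h}\sum_{h+1\le s<t\le n}(\mathbf{U}_{n,s-h}'\mathbf{U}_{n,t-h})(\mathbf{U}_{ns}'\mathbf{U}_{nt})$$ converges in distribution to the standard normal distribution as $n\to\infty$.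
   Context: A distribution on $\mathbb{R}^p$ has spherical directions if it puts no mass at the origin and, for $\mathbf{X}$ with this distribution, $\mathbf{X}/\|\mathbf{X}\|$ is uniformly distributed on the unit sphere $\mathcal{S}^{p-1}$. $\|\mathbf{A}\|_{\rm Fr}=({\rm Trace}(\mathbf{A}\mathbf{A}'))^{1/2}$ is the Frobenius norm. *)

theory Defs
  imports "HOL-Probability.Probability"
begin

text \<open>Vectors of R^p are represented as functions nat => real, extensional on {..<p}.\<close>

definition vnorm :: "nat \<Rightarrow> (nat \<Rightarrow> real) \<Rightarrow> real" where
  "vnorm p x = sqrt (\<Sum>i<p. (x i)\<^sup>2)"

definition unit_dir :: "nat \<Rightarrow> (nat \<Rightarrow> real) \<Rightarrow> (nat \<Rightarrow> real)" where
  "unit_dir p x = (\<lambda>i\<in>{..<p}. x i / vnorm p x)"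

definition zero_vec :: "nat \<Rightarrow> (nat \<Rightarrow> real)" where
  "zero_vec p = (\<lambda>i\<in>{..<p}. 0)"

definition RV :: "nat \<Rightarrow> (nat \<Rightarrow> real) measure" where
  "RV p = PiM {..<p} (\<lambda>_. borel)"

definition LebV :: "nat \<Rightarrow> (nat \<Rightarrow> real) measure" where
  "LebV p = PiM {..<p} (\<lambda>_. lborel)"

text \<open>Spherical directions: no mass at the origin and X/|X| uniform on the unit sphere.
  The uniform (normalized surface) measure of a Borel set A of the sphere is given as the
  normalized Lebesgue measure of the cone {r u : 0 < r <= 1, u in A}.\<close>
definition spherical_directions :: "nat \<Rightarrow> (nat \<Rightarrow> real) measure \<Rightarrow> bool" where
  "spherical_directions p N \<longleftrightarrow>
     prob_space N \<and> sets N = sets (RV p) \<and>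
     measure N {zero_vec p} = 0 \<and>
     (\<forall>A \<in> sets (RV p).
        measure N {x \<in> space N. x \<noteq> zero_vec p \<and> unit_dir p x \<in> A} =
        measure (LebV p) {x \<in> space (LebV p). 0 < vnorm p x \<and> vnorm p x \<le> 1 \<and> unit_dir p x \<in> A}
        / measure (LebV p) {x \<in> space (LebV p). vnorm p x \<le> 1})"

definition r_mat :: "nat \<Rightarrow> nat \<Rightarrow> nat \<Rightarrow> (nat \<Rightarrow> nat \<Rightarrow> real) \<Rightarrow> nat \<Rightarrow> nat \<Rightarrow> real" where
  "r_mat p n h U i j = real p / real (n - h) * (\<Sum>t\<in>{h+1..n}. U t i * U (t - h) j)"

definition frob_sq :: "nat \<Rightarrow> (nat \<Rightarrow> nat \<Rightarrow> real) \<Rightarrow> real" where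
  "frob_sq p A = (\<Sum>i<p. \<Sum>j<p. (A i j)\<^sup>2)"

definition T_stat :: "nat \<Rightarrow> nat \<Rightarrow> nat \<Rightarrow> (nat \<Rightarrow> nat \<Rightarrow> real) \<Rightarrow> real" where
  "T_stat H p n U = (\<Sum>h\<in>{1..H}. real (n - h) * frob_sq p (r_mat p n h U))"

definition T_St :: "nat \<Rightarrow> nat \<Rightarrow> nat \<Rightarrow> (nat \<Rightarrow> nat \<Rightarrow> real) \<Rightarrow> real" where
  "T_St H p n U = (T_stat H p n U - real H * (real p)\<^sup>2) / sqrt (2 * real H * (real p)\<^sup>2)"

definition T_St_alt :: "nat \<Rightarrow> nat \<Rightarrow> nat \<Rightarrow> (nat \<Rightarrow> nat \<Rightarrow> real) \<Rightarrow> real" where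
  "T_St_alt H p n U = sqrt (2 * (real p)\<^sup>2) / sqrt (real H) *
     (\<Sum>h\<in>{1..H}. 1 / real (n - h) *
        (\<Sum>(s, t) \<in> {(s, t). h + 1 \<le> s \<and> s < t \<and> t \<le> n}.
           (\<Sum>i<p. U (s - h) i * U (t - h) i) * (\<Sum>i<p. U s i * U t i)))"

end

theory Submission
  imports Defs
begin

text \<open>
  Write \<open>T\<^sup>S\<^sup>t = \<Sum>\<^sub>t D\<^sub>t\<close> with \<open>D\<^sub>t = c \<langle>W\<^sub>t, U\<^sub>t\<rangle>\<close>, where \<open>W\<^sub>t\<close> depends on \<open>U\<^sub>1, \<dots>, U\<^sub>t\<^sub>-\<^sub>1\<close> only. The
  uniform law on the sphere inherits from Lebesgue measure the invariance under sign changes of a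
  coordinate and under a reflection at 45 degrees in two coordinates; this determines its moments
  up to order four. Hence the \<open>D\<^sub>t\<close> are martingale differences with conditional variance
  \<open>c\<^sup>2 |W\<^sub>t|\<^sup>2 / p\<close> and conditional fourth moment at most \<open>3 (c\<^sup>2 |W\<^sub>t|\<^sup>2 / p)\<^sup>2\<close>.

  No general martingale central limit theorem is needed: since \<open>p \<rightarrow> \<infinity>\<close>, every single \<open>|W\<^sub>t|\<^sup>2\<close> is
  concentrated around a constant, with relative variance \<open>O(1/p + 1/t)\<close>. Replacing the conditional
  variances by constants \<open>\<delta>\<^sub>t\<close>, the expectations of \<open>cos (\<theta> + u S\<^sub>t)\<close> are compared with
  \<open>exp (- u\<^sup>2 (\<delta>\<^sub>1 + \<dots> + \<delta>\<^sub>t) / 2) cos \<theta>\<close> step by step, and the sum of the \<open>\<delta>\<^sub>t\<close> tends to 1.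

  For the concentration, the terms of \<open>W\<^sub>t\<close> whose time index is within \<open>H\<close> of \<open>t\<close> or of the origin
  are split off (their total is negligible in \<open>L\<^sup>2\<close>); the remaining \<open>|W\<^sub>t|\<^sup>2\<close> is built up one time
  index at a time, as a sum of nearly uncorrelated squares plus a martingale whose relative variance is
  \<open>O(1/p)\<close>.
\<close>

section \<open>The uniform distribution on the sphere\<close>

definition dot :: "nat \<Rightarrow> (nat \<Rightarrow> real) \<Rightarrow> (nat \<Rightarrow> real) \<Rightarrow> real" where
  "dot p x y = (\<Sum>i<p. x i * y i)"

text \<open>Two affine substitutions on the line do the work of a planar change of variables:
  \<open>u = (x + y) / sqrt 2\<close> at fixed \<open>y\<close>, then, after exchanging the
  integrals, \<open>v = u - sqrt 2 * y\<close> at fixed \<open>u\<close>. The factor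
  \<open>sqrt 2\<close> produced by the first is used up by the second.\<close>

lemma nn_integral_reflect45:
  fixes g :: "real \<Rightarrow> real \<Rightarrow> ennreal"
  assumes [measurable]: "case_prod g \<in> borel_measurable (lborel \<Otimes>\<^sub>M lborel)"
  shows "(\<integral>\<^sup>+y. \<integral>\<^sup>+x. g ((x + y) / sqrt 2) ((x - y) / sqrt 2) \<partial>lborel \<partial>lborel)
    = (\<integral>\<^sup>+y. \<integral>\<^sup>+x. g x y \<partial>lborel \<partial>lborel)"
proof -
  have e: "(sqrt 2 * u - y + y) / sqrt 2 = u" "(sqrt 2 * u - y - y) / sqrt 2 = u - sqrt 2 * y" for u y :: real
    by (auto simp: field_simps)
  have e': "(sqrt 2 * u - 2 * y) / sqrt 2 = u - sqrt 2 * y" for u y :: real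
    using e(2)[of u y] by simp
  have [measurable]: "case_prod g \<in> borel_measurable (borel \<Otimes>\<^sub>M borel)"
    using assms by (simp cong: measurable_cong_sets sets_pair_measure_cong)
  have "(\<integral>\<^sup>+x. g ((x + y) / sqrt 2) ((x - y) / sqrt 2) \<partial>lborel)
      = ennreal (sqrt 2) * (\<integral>\<^sup>+u. g u (u - sqrt 2 * y) \<partial>lborel)" for y
    by (subst nn_integral_real_affine[where c="sqrt 2" and t="-y"]) (auto simp: e e')
  then have "(\<integral>\<^sup>+y. \<integral>\<^sup>+x. g ((x + y) / sqrt 2) ((x - y) / sqrt 2) \<partial>lborel \<partial>lborel)
     = (\<integral>\<^sup>+y. \<integral>\<^sup>+u. ennreal (sqrt 2) * g u (u - sqrt 2 * y) \<partial>lborel \<partial>lborel)"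
    by (simp add: nn_integral_cmult)
  also have "\<dots> = (\<integral>\<^sup>+u. \<integral>\<^sup>+y. ennreal (sqrt 2) * g u (u - sqrt 2 * y) \<partial>lborel \<partial>lborel)"
    by (rule lborel_pair.Fubini') simp
  also have "\<dots> = (\<integral>\<^sup>+u. \<integral>\<^sup>+v. g u v \<partial>lborel \<partial>lborel)"
  proof (rule nn_integral_cong)
    fix u :: real
    show "(\<integral>\<^sup>+y. ennreal (sqrt 2) * g u (u - sqrt 2 * y) \<partial>lborel) = (\<integral>\<^sup>+v. g u v \<partial>lborel)"
      by (subst (2) nn_integral_real_affine[where c="-sqrt 2" and t=u]) (auto simp: nn_integral_cmult)
  qed
  also have "\<dots> = (\<integral>\<^sup>+v. \<integral>\<^sup>+u. g u v \<partial>lborel \<partial>lborel)"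
    by (rule lborel_pair.Fubini') (use assms in \<open>simp add: case_prod_unfold\<close>)
  finally show ?thesis .
qed

lemma sets_LebV: "sets (LebV p) = sets (RV p)"
  unfolding LebV_def RV_def by (intro sets_PiM_cong) auto

lemma space_RV: "space (RV p) = extensional {..<p}"
  by (auto simp: RV_def space_PiM PiE_def)

lemma measurable_RV_component [measurable]: "i < p \<Longrightarrow> (\<lambda>x. x i) \<in> borel_measurable (RV p)"
  unfolding RV_def by (rule measurable_component_singleton) auto

lemma measurable_dot:
  "m \<le> p \<Longrightarrow> (\<lambda>y. dot m w y) \<in> borel_measurable (RV p)"
  unfolding dot_def by (intro borel_measurable_sum borel_measurable_times measurable_const measurable_RV_component) auto

lemma measurable_vnorm [measurable]: "vnorm p \<in> borel_measurable (RV p)"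
  unfolding vnorm_def by measurable

lemma measurable_unit_dir [measurable]: "unit_dir p \<in> measurable (RV p) (RV p)"
  unfolding unit_dir_def by (subst (2) RV_def, rule measurable_restrict) simp

lemma measurable_fun_upd_RV:
  assumes "i < p" "f \<in> measurable M (RV p)" "g \<in> borel_measurable M"
  shows "(\<lambda>x. (f x)(i := g x)) \<in> measurable M (RV p)"
proof -
  have "insert i {..<p} = {..<p}" using assms(1) by auto
  then show ?thesis
    using measurable_fun_upd[of "{..<p}" "{..<p}" i f M "\<lambda>_. borel" g] assms
    by (auto simp: RV_def)
qed

section \<open>Sign changes and plane reflections that preserve Lebesgue measure\<close>

definition flip :: "nat \<Rightarrow> (nat \<Rightarrow> real) \<Rightarrow> nat \<Rightarrow> real" where
  "flip i x = x(i := - x i)"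

text \<open>For \<open>i \<noteq> j\<close> this is an orthogonal involution of the plane of
  coordinates \<open>i\<close> and \<open>j\<close>. It mixes the two with equal weights, so that
  invariance under it ties their pure moments to the mixed ones; together with sign changes it takes
  the place of general rotations.\<close>

definition refl45 :: "nat \<Rightarrow> nat \<Rightarrow> (nat \<Rightarrow> real) \<Rightarrow> nat \<Rightarrow> real" where
  "refl45 i j x = x(i := (x i + x j) / sqrt 2, j := (x i - x j) / sqrt 2)"

lemma measurable_flip [measurable]: "i < p \<Longrightarrow> flip i \<in> measurable (RV p) (RV p)"
  unfolding flip_def by (intro measurable_fun_upd_RV) auto

lemma measurable_refl45 [measurable]: "i < p \<Longrightarrow> j < p \<Longrightarrow> refl45 i j \<in> measurable (RV p) (RV p)"
  unfolding refl45_def by (intro measurable_fun_upd_RV) auto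

lemma sum_lessThan_split2:
  fixes i j p :: nat and f :: "nat \<Rightarrow> real"
  assumes "i < p" "j < p" "i \<noteq> j"
  shows "(\<Sum>k<p. f k) = f i + f j + (\<Sum>k\<in>{..<p} - {i, j}. f k)"
proof -
  have "{..<p} = insert i (insert j ({..<p} - {i, j}))" using assms by auto
  then have "sum f {..<p} = sum f (insert i (insert j ({..<p} - {i, j})))" by simp
  also have "\<dots> = f i + f j + (\<Sum>k\<in>{..<p} - {i, j}. f k)"
    using assms(3) by (subst sum.insert; simp)
  finally show ?thesis .
qed

lemma vnorm_flip: "vnorm p (flip i x) = vnorm p x"
  unfolding vnorm_def flip_def by (intro arg_cong[where f=sqrt] sum.cong) auto

lemma vnorm_refl45: "i < p \<Longrightarrow> j < p \<Longrightarrow> i \<noteq> j \<Longrightarrow> vnorm p (refl45 i j x) = vnorm p x"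
  unfolding vnorm_def
  by (simp add: sum_lessThan_split2[of i p j] refl45_def power_divide)
     (simp add: power2_eq_square field_simps)

lemma unit_dir_flip: "i < p \<Longrightarrow> unit_dir p (flip i x) = flip i (unit_dir p x)"
  by (auto simp: unit_dir_def vnorm_flip) (auto simp: flip_def fun_eq_iff)

lemma unit_dir_refl45:
  "i < p \<Longrightarrow> j < p \<Longrightarrow> i \<noteq> j \<Longrightarrow> unit_dir p (refl45 i j x) = refl45 i j (unit_dir p x)"
  by (auto simp: unit_dir_def vnorm_refl45)
     (auto simp: refl45_def fun_eq_iff add_divide_distrib diff_divide_distrib mult.commute)

lemma nn_integral_LebV_flip:
  assumes i: "i < p" and f [measurable]: "f \<in> borel_measurable (RV p)"
  shows "(\<integral>\<^sup>+x. f (flip i x) \<partial>LebV p) = (\<integral>\<^sup>+x. f x \<partial>LebV p)"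
proof -
  interpret product_sigma_finite "\<lambda>_::nat. lborel :: real measure" by standard
  define K where "K = {..<p} - {i}"
  have K: "finite K" "i \<notin> K" and eq: "insert i K = {..<p}" using i by (auto simp: K_def)
  have L: "LebV p = PiM (insert i K) (\<lambda>_. lborel)" by (simp add: LebV_def eq)
  have m: "f \<in> borel_measurable (PiM (insert i K) (\<lambda>_. lborel))"
    using f sets_LebV[of p] unfolding L[symmetric] by (simp cong: measurable_cong_sets)
  have m2: "(\<lambda>x. f (flip i x)) \<in> borel_measurable (PiM (insert i K) (\<lambda>_. lborel))"
    unfolding L[symmetric] using i sets_LebV[of p] by (simp cong: measurable_cong_sets)
  have "(\<integral>\<^sup>+y. f (flip i (x(i := y))) \<partial>lborel) = (\<integral>\<^sup>+y. f (x(i := y)) \<partial>lborel)"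
    if "x \<in> space (PiM K (\<lambda>_. lborel :: real measure))" for x
  proof -
    have [measurable]: "(\<lambda>y. f (x(i := y))) \<in> borel_measurable borel"
      using measurable_compose[OF measurable_component_update[OF that K(2)] m]
      by (simp add: lborel_def)
    show ?thesis
      by (subst (2) nn_integral_real_affine[where c="-1" and t=0]) (auto simp: flip_def)
  qed
  then show ?thesis
    unfolding L by (simp add: product_nn_integral_insert[OF K] m m2 cong: nn_integral_cong)
qed

text \<open>Coordinates \<open>i\<close> and \<open>j\<close> are integrated innermost; for each
  choice of the remaining ones the claim is the planar identity
  \<open>nn_integral_reflect45\<close>.\<close>

lemma nn_integral_LebV_refl45:
  assumes i: "i < p" "j < p" "i \<noteq> j" and f [measurable]: "f \<in> borel_measurable (RV p)"
  shows "(\<integral>\<^sup>+x. f (refl45 i j x) \<partial>LebV p) = (\<integral>\<^sup>+x. f x \<partial>LebV p)"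
proof -
  interpret product_sigma_finite "\<lambda>_::nat. lborel :: real measure" by standard
  define K where "K = {..<p} - {i, j}"
  have K: "finite K" "j \<notin> K" and K': "finite (insert j K)" "i \<notin> insert j K"
    and eq: "insert i (insert j K) = {..<p}" using i by (auto simp: K_def)
  have L: "LebV p = PiM (insert i (insert j K)) (\<lambda>_. lborel)" by (simp add: LebV_def eq)
  have fold: "(\<integral>\<^sup>+x. g x \<partial>LebV p)
      = (\<integral>\<^sup>+z. \<integral>\<^sup>+y. \<integral>\<^sup>+x. g (z(j := y, i := x)) \<partial>lborel \<partial>lborel \<partial>PiM K (\<lambda>_. lborel))"
    if "g \<in> borel_measurable (RV p)" for g :: "(nat \<Rightarrow> real) \<Rightarrow> ennreal"
  proof -
    have m: "g \<in> borel_measurable (PiM (insert i (insert j K)) (\<lambda>_. lborel))"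
      using that sets_LebV[of p] unfolding L[symmetric] by (simp cong: measurable_cong_sets)
    have m1: "(\<lambda>(z, x). g (z(i := x))) \<in> borel_measurable (PiM (insert j K) (\<lambda>_. lborel) \<Otimes>\<^sub>M lborel)"
      using measurable_compose[OF measurable_add_dim m] by (simp add: case_prod_unfold)
    then have "(\<lambda>z. \<integral>\<^sup>+x. g (z(i := x)) \<partial>lborel) \<in> borel_measurable (PiM (insert j K) (\<lambda>_. lborel))"
      by (rule lborel.borel_measurable_nn_integral)
    then show ?thesis
      unfolding L by (simp add: product_nn_integral_insert[OF K] product_nn_integral_insert[OF K'] m)
  qed
  have "(\<integral>\<^sup>+y. \<integral>\<^sup>+x. f (refl45 i j (z(j := y, i := x))) \<partial>lborel \<partial>lborel)
      = (\<integral>\<^sup>+y. \<integral>\<^sup>+x. f (z(j := y, i := x)) \<partial>lborel \<partial>lborel)"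
    if z: "z \<in> space (PiM K (\<lambda>_. lborel :: real measure))" for z
  proof -
    have sp: "(\<lambda>_. z) \<in> measurable (lborel \<Otimes>\<^sub>M lborel) (PiM K (\<lambda>_. lborel))" using z by simp
    have "(\<lambda>w. z(j := snd w, i := fst w)) \<in> measurable (lborel \<Otimes>\<^sub>M lborel)
        (PiM (insert i (insert j K)) (\<lambda>_. lborel :: real measure))"
      by (rule measurable_fun_upd[where J="insert j K"], simp,
          rule measurable_fun_upd[where J=K], simp, rule sp) auto
    then have "(\<lambda>w. z(j := snd w, i := fst w)) \<in> measurable (lborel \<Otimes>\<^sub>M lborel) (RV p)"
      unfolding L[symmetric] using sets_LebV[of p] by (simp cong: measurable_cong_sets)
    then have m: "(\<lambda>(x, y). f (z(j := y, i := x))) \<in> borel_measurable (lborel \<Otimes>\<^sub>M lborel)"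
      using measurable_compose[OF _ f] by (simp add: case_prod_unfold)
    have "refl45 i j (z(j := y, i := x)) = z(j := (x - y) / sqrt 2, i := (x + y) / sqrt 2)" for x y
      using i by (auto simp: refl45_def fun_eq_iff)
    then show ?thesis
      using nn_integral_reflect45[OF m] by simp
  qed
  then show ?thesis
    using i by (simp add: fold cong: nn_integral_cong)
qed


section \<open>From Lebesgue volumes of cones to the law of the direction\<close>

lemma vnorm_pos:
  assumes "x \<in> space (RV p)" "x \<noteq> zero_vec p"
  shows "vnorm p x > 0"
proof -
  have "vnorm p x \<noteq> 0"
  proof
    assume "vnorm p x = 0"
    then have "x i = 0" if "i < p" for i
      using that by (auto simp: vnorm_def sum_nonneg_eq_0_iff)
    with assms show False
      by (auto simp: zero_vec_def space_RV extensional_def fun_eq_iff split: if_splits)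
  qed
  moreover have "vnorm p x \<ge> 0" by (simp add: vnorm_def sum_nonneg)
  ultimately show ?thesis by simp
qed

lemma vnorm_zero_vec: "vnorm p (zero_vec p) = 0"
  by (simp add: vnorm_def zero_vec_def)

lemma dot_unit_dir: "vnorm p x > 0 \<Longrightarrow> dot p (unit_dir p x) (unit_dir p x) = 1"
proof -
  assume v: "vnorm p x > 0"
  have "dot p (unit_dir p x) (unit_dir p x) = (\<Sum>i<p. (x i)\<^sup>2) / (vnorm p x)\<^sup>2"
    unfolding sum_divide_distrib dot_def by (intro sum.cong) (auto simp: unit_dir_def power2_eq_square)
  also have "(\<Sum>i<p. (x i)\<^sup>2) = (vnorm p x)\<^sup>2" by (simp add: vnorm_def sum_nonneg)
  finally show ?thesis using v by simp
qed

locale spherical =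
  fixes p :: nat and N :: "(nat \<Rightarrow> real) measure"
  assumes sph: "spherical_directions p N" and p_ge: "p \<ge> 1"
begin

definition dir :: "(nat \<Rightarrow> real) measure" where
  "dir = distr N (RV p) (unit_dir p)"

lemma sets_N [measurable_cong]: "sets N = sets (RV p)"
  using sph by (simp add: spherical_directions_def)

lemma space_N: "space N = space (RV p)"
  using sets_N by (rule sets_eq_imp_space_eq)

lemma prob_space_N: "prob_space N"
  using sph by (simp add: spherical_directions_def)

lemma sets_dir [measurable_cong]: "sets dir = sets (RV p)"
  by (simp add: dir_def)

lemma prob_space_dir: "prob_space dir"
  unfolding dir_def by (rule prob_space.prob_space_distr[OF prob_space_N]) measurable

lemma zero_vec_eq: "x \<in> space (RV p) \<Longrightarrow> x = zero_vec p \<longleftrightarrow> vnorm p x = 0"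
  using vnorm_pos[of x p] vnorm_zero_vec[of p] by force

lemma AE_N_pos: "AE x in N. vnorm p x > 0"
proof -
  interpret prob_space N by (rule prob_space_N)
  have z: "zero_vec p \<in> space (RV p)" by (simp add: zero_vec_def space_RV)
  then have eq: "{zero_vec p} = {x \<in> space N. vnorm p x = 0}"
    using zero_vec_eq by (auto simp: space_N vnorm_zero_vec)
  have m: "{zero_vec p} \<in> sets N" unfolding eq by measurable
  have "emeasure N {zero_vec p} = 0"
    using sph by (simp add: spherical_directions_def emeasure_eq_measure)
  then have "AE x in N. x \<notin> {zero_vec p}"
    using m by (intro AE_not_in) (auto simp: null_sets_def)
  moreover have "AE x in N. x \<in> space N" by (rule AE_space)
  ultimately show ?thesis by eventually_elim (auto intro: vnorm_pos simp: space_N)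
qed

lemma AE_dir_unit: "AE y in dir. dot p y y = 1"
proof -
  have [measurable]: "(\<lambda>y. dot p y y) \<in> borel_measurable (RV p)" unfolding dot_def by measurable
  show ?thesis unfolding dir_def
    by (subst AE_distr_iff) (use AE_N_pos in \<open>auto elim!: eventually_mono simp: dot_unit_dir\<close>)
qed

text \<open>Since the origin has no mass, cutting it out of the preimage of \<open>A\<close> changes
  nothing, and what is left is the event measured by the cone formula in
  \<open>spherical_directions\<close>.\<close>

lemma measure_dir:
  assumes A [measurable]: "A \<in> sets (RV p)"
  shows "measure dir A =
     measure (LebV p) {x \<in> space (RV p). 0 < vnorm p x \<and> vnorm p x \<le> 1 \<and> unit_dir p x \<in> A}
        / measure (LebV p) {x \<in> space (RV p). vnorm p x \<le> 1}"
proof -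
  interpret prob_space N by (rule prob_space_N)
  have "measure dir A = measure N (unit_dir p -` A \<inter> space N)"
    unfolding dir_def by (rule measure_distr) auto
  also have "\<dots> = measure N {x \<in> space N. x \<noteq> zero_vec p \<and> unit_dir p x \<in> A}"
  proof (rule finite_measure_eq_AE)
    show "AE x in N. x \<in> unit_dir p -` A \<inter> space N
        \<longleftrightarrow> x \<in> {x \<in> space N. x \<noteq> zero_vec p \<and> unit_dir p x \<in> A}"
      using AE_N_pos by eventually_elim (auto simp: vnorm_zero_vec)
    show "unit_dir p -` A \<inter> space N \<in> sets N" by measurable
    have "{x \<in> space N. x \<noteq> zero_vec p \<and> unit_dir p x \<in> A}
        = {x \<in> space N. vnorm p x \<noteq> 0 \<and> unit_dir p x \<in> A}"
      using zero_vec_eq by (auto simp: space_N)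
    also have "\<dots> \<in> sets N" by measurable
    finally show "{x \<in> space N. x \<noteq> zero_vec p \<and> unit_dir p x \<in> A} \<in> sets N" .
  qed
  finally show ?thesis
    using sph A sets_eq_imp_space_eq[OF sets_LebV[of p]] by (simp add: spherical_directions_def)
qed

text \<open>A map \<open>R\<close> that preserves norms and commutes with normalization pulls the
  truncated cone \<open>S A\<close> back to the truncated cone over the preimage of
  \<open>A\<close>. As \<open>R\<close> also preserves Lebesgue measure, both cones have the same
  volume.\<close>

lemma distr_dir_invariant:
  assumes R [measurable]: "R \<in> measurable (RV p) (RV p)"
    and leb: "\<And>f :: _ \<Rightarrow> ennreal. f \<in> borel_measurable (RV p) \<Longrightarrow>
        (\<integral>\<^sup>+x. f (R x) \<partial>LebV p) = (\<integral>\<^sup>+x. f x \<partial>LebV p)"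
    and nR: "\<And>x. vnorm p (R x) = vnorm p x"
    and uR: "\<And>x. unit_dir p (R x) = R (unit_dir p x)"
  shows "distr dir (RV p) R = dir"
proof (rule measure_eqI)
  interpret prob_space dir by (rule prob_space_dir)
  fix A assume "A \<in> sets (distr dir (RV p) R)"
  then have A [measurable]: "A \<in> sets (RV p)" by simp
  define S where "S A = {x \<in> space (RV p). 0 < vnorm p x \<and> vnorm p x \<le> 1 \<and> unit_dir p x \<in> A}" for A
  have sS: "S A \<in> sets (RV p)" if [measurable]: "A \<in> sets (RV p)" for A
    unfolding S_def by measurable
  have RA: "R -` A \<inter> space (RV p) \<in> sets (RV p)" by measurable
  have u: "unit_dir p x \<in> space (RV p)" for x by (auto simp: unit_dir_def space_RV)
  have eq: "indicator (S (R -` A \<inter> space (RV p))) x = (indicator (S A) (R x) :: ennreal)"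
    if "x \<in> space (RV p)" for x
    using that measurable_space[OF R that] u by (auto simp: S_def nR uR indicator_def)
  have "emeasure (LebV p) (S (R -` A \<inter> space (RV p)))
      = (\<integral>\<^sup>+x. indicator (S A) (R x) \<partial>LebV p)"
    unfolding nn_integral_indicator[of "S _" "LebV p", unfolded sets_LebV, OF sS[OF RA], symmetric]
    by (intro nn_integral_cong eq) (simp add: sets_eq_imp_space_eq[OF sets_LebV[of p]])
  also have "\<dots> = emeasure (LebV p) (S A)"
    using sS[OF A] by (subst leb) (auto simp: sets_LebV)
  finally have "measure dir (R -` A \<inter> space (RV p)) = measure dir A"
    unfolding measure_dir[OF RA] measure_dir[OF A] S_def[symmetric] by (simp add: measure_def)
  then show "emeasure (distr dir (RV p) R) A = emeasure dir A"
    by (simp add: emeasure_distr sets_eq_imp_space_eq[OF sets_dir] emeasure_eq_measure)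
qed (simp add: sets_dir)

lemma integral_flip:
  assumes "i < p" and f: "f \<in> borel_measurable (RV p)"
  shows "(\<integral>y. f (flip i y) \<partial>dir) = (\<integral>y. f y \<partial>dir :: real)"
proof -
  have "distr dir (RV p) (flip i) = dir"
    using assms(1) by (intro distr_dir_invariant nn_integral_LebV_flip vnorm_flip unit_dir_flip) auto
  then have "(\<integral>y. f y \<partial>dir) = (\<integral>y. f y \<partial>distr dir (RV p) (flip i))" by simp
  also have "\<dots> = (\<integral>y. f (flip i y) \<partial>dir)"
    using assms by (intro integral_distr) (auto simp: measurable_cong_sets[OF sets_dir refl])
  finally show ?thesis ..
qed

lemma integral_refl45:
  assumes "i < p" "j < p" "i \<noteq> j" and f: "f \<in> borel_measurable (RV p)"
  shows "(\<integral>y. f (refl45 i j y) \<partial>dir) = (\<integral>y. f y \<partial>dir :: real)"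
proof -
  have "distr dir (RV p) (refl45 i j) = dir"
    using assms by (intro distr_dir_invariant nn_integral_LebV_refl45 vnorm_refl45 unit_dir_refl45) auto
  then have "(\<integral>y. f y \<partial>dir) = (\<integral>y. f y \<partial>distr dir (RV p) (refl45 i j))" by simp
  also have "\<dots> = (\<integral>y. f (refl45 i j y) \<partial>dir)"
    using assms by (intro integral_distr) (auto simp: measurable_cong_sets[OF sets_dir refl])
  finally show ?thesis ..
qed

lemma integral_odd:
  assumes "i < p" "f \<in> borel_measurable (RV p)" "\<And>y. f (flip i y) = - f y"
  shows "(\<integral>y. f y \<partial>dir :: real) = 0"
  using integral_flip[OF assms(1,2)] assms(3) by simp


section \<open>Moments of the uniform direction up to order four\<close>

lemma coord_le_1:
  assumes "dot p y y = 1" "i < p"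
  shows "\<bar>y i\<bar> \<le> 1"
proof -
  have "(y i)\<^sup>2 \<le> (\<Sum>i<p. (y i)\<^sup>2)"
    using assms(2) by (intro member_le_sum) auto
  then show ?thesis
    using assms(1) by (simp add: dot_def power2_eq_square[symmetric] abs_square_le_1)
qed

lemma integrable_dir_bounded:
  fixes f :: "(nat \<Rightarrow> real) \<Rightarrow> real"
  assumes "f \<in> borel_measurable (RV p)" "\<And>y. (\<And>i. i < p \<Longrightarrow> \<bar>y i\<bar> \<le> 1) \<Longrightarrow> \<bar>f y\<bar> \<le> C"
  shows "integrable dir f"
proof -
  interpret prob_space dir by (rule prob_space_dir)
  show ?thesis
  proof (rule integrable_const_bound)
    show "AE y in dir. norm (f y) \<le> C"
      using AE_dir_unit by eventually_elim (use coord_le_1 assms(2) in auto)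
    show "f \<in> borel_measurable dir" using assms(1) by (simp add: measurable_cong_sets[OF sets_dir refl])
  qed
qed

lemma integrable_dir_dot_power:
  assumes "m \<le> p" "k < p"
  shows "integrable dir (\<lambda>y. dot m w y ^ a * y k ^ b)"
proof (rule integrable_dir_bounded)
  show "(\<lambda>y. dot m w y ^ a * y k ^ b) \<in> borel_measurable (RV p)"
    using assms by (intro borel_measurable_times borel_measurable_power measurable_dot) auto
  fix y :: "nat \<Rightarrow> real"
  assume y: "\<And>i. i < p \<Longrightarrow> \<bar>y i\<bar> \<le> 1"
  have "\<bar>dot m w y\<bar> \<le> (\<Sum>i<m. \<bar>w i\<bar>)"
    unfolding dot_def using assms y
    by (intro order_trans[OF sum_abs] sum_mono) (auto simp: abs_mult intro!: mult_left_le)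
  then have "\<bar>dot m w y\<bar> ^ a \<le> (\<Sum>i<m. \<bar>w i\<bar>) ^ a"
    by (intro power_mono) auto
  moreover have "\<bar>y k\<bar> ^ b \<le> 1" using y assms by (simp add: power_le_one)
  ultimately have "\<bar>dot m w y\<bar> ^ a * \<bar>y k\<bar> ^ b \<le> (\<Sum>i<m. \<bar>w i\<bar>) ^ a * 1"
    by (intro mult_mono) (auto simp: sum_nonneg)
  then show "\<bar>dot m w y ^ a * y k ^ b\<bar> \<le> (\<Sum>i<m. \<bar>w i\<bar>) ^ a"
    by (simp add: abs_mult power_abs)
qed

lemma integrable_dir_coord2: "i < p \<Longrightarrow> j < p \<Longrightarrow> integrable dir (\<lambda>y. y i ^ a * y j ^ b)"
  by (rule integrable_dir_bounded[where C=1])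
     (auto simp: abs_mult power_abs intro!: mult_le_one power_le_one)

text \<open>The truncated product \<open>dot m w\<close> reads only coordinates below
  \<open>m \<le> k\<close>, so a sign change of coordinate \<open>k\<close> affects nothing but the
  odd power. This is why the moments below are computed by adding coordinates one at a time.\<close>

lemma integral_dot_odd:
  assumes "m \<le> k" "k < p" "odd b"
  shows "(\<integral>y. dot m w y ^ a * y k ^ b \<partial>dir) = 0"
proof (rule integral_odd[OF assms(2)])
  have "m \<le> p" using assms by simp
  then show "(\<lambda>y. dot m w y ^ a * y k ^ b) \<in> borel_measurable (RV p)"
    using assms by (intro borel_measurable_times borel_measurable_power measurable_dot) auto
  fix y
  have "dot m w (flip k y) = dot m w y"
    unfolding dot_def using assms by (intro sum.cong) (auto simp: flip_def)
  then show "dot m w (flip k y) ^ a * flip k y k ^ b = - (dot m w y ^ a * y k ^ b)"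
    using assms(3) by (simp add: flip_def)
qed

lemma integral_coord_odd:
  assumes "i < p" "j < p" "i \<noteq> j" "odd b"
  shows "(\<integral>y. y i ^ a * y j ^ b \<partial>dir) = 0"
  by (rule integral_odd[OF assms(2)]) (use assms in \<open>auto simp: flip_def\<close>)

text \<open>Apply the reflection to \<open>y j ^ 2\<close>, \<open>y i ^ 4\<close> and
  \<open>y j ^ 4\<close> and drop the terms odd in a coordinate. For the fourth moments
  \<open>A\<close>, \<open>B\<close> of the two coordinates and their mixed moment \<open>C\<close>,
  both \<open>A\<close> and \<open>B\<close> equal \<open>(A + B + 6 * C) / 4\<close>, hence
  \<open>A = B = 3 * C\<close>.\<close>

lemma integral_power_coord:
  assumes "i < p" "j < p" "i \<noteq> j"
  shows "(\<integral>y. y i ^ 2 \<partial>dir) = (\<integral>y. y j ^ 2 \<partial>dir)"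
    and "(\<integral>y. y i ^ 4 \<partial>dir) = (\<integral>y. y j ^ 4 \<partial>dir)"
    and "(\<integral>y. y i ^ 4 \<partial>dir) = 3 * (\<integral>y. y i ^ 2 * y j ^ 2 \<partial>dir)"
proof -
  note [simp] = integrable_dir_coord2[OF assms(1,2)]
    integrable_dir_coord2[OF assms(1,2), where b=0, simplified]
    integrable_dir_coord2[OF assms(1,2), where a=0, simplified]
    integrable_dir_coord2[OF assms(1,2), where a=1 and b=1, simplified]
    integrable_dir_coord2[OF assms(1,2), where b=1, simplified]
    integrable_dir_coord2[OF assms(1,2), where a=1, simplified]
  have lin: "a = (a + b + 6 * c) / 4 \<Longrightarrow> a = b \<Longrightarrow> a = 3 * c" for a b c :: real by simp
  note odd = integral_coord_odd[OF assms, where b=1, simplified]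
    integral_coord_odd[OF assms(2,1) assms(3)[symmetric], where b=1, simplified]
  have r2: "refl45 i j y j ^ 2 = (y i ^ 2 + y j ^ 2) / 2 - y i * y j" for y
    using assms(3) by (simp add: refl45_def power_divide power2_diff)
  have "(\<integral>y. y j ^ 2 \<partial>dir) = (\<integral>y. refl45 i j y j ^ 2 \<partial>dir)"
    using assms by (subst integral_refl45) auto
  also have "\<dots> = ((\<integral>y. y i ^ 2 \<partial>dir) + (\<integral>y. y j ^ 2 \<partial>dir)) / 2"
    unfolding r2 using odd(1)[of 1] by simp
  finally show "(\<integral>y. y i ^ 2 \<partial>dir) = (\<integral>y. y j ^ 2 \<partial>dir)" by simp
  have s4: "sqrt 2 ^ 4 = 4"
    using real_sqrt_pow2[of 2] power_mult[of "sqrt 2" 2 2] by simp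
  have r4: "refl45 i j y i ^ 4 = (y i ^ 4 + y j ^ 4 + 6 * (y i ^ 2 * y j ^ 2)) / 4 + y i ^ 3 * y j + y j ^ 3 * y i"
    "refl45 i j y j ^ 4 = (y i ^ 4 + y j ^ 4 + 6 * (y i ^ 2 * y j ^ 2)) / 4 - y i ^ 3 * y j - y j ^ 3 * y i" for y
    using assms(3) by (auto simp: refl45_def power_divide s4) (auto simp: field_simps power2_eq_square power3_eq_cube power4_eq_xxxx)
  note io = integrable_dir_coord2[OF assms(2,1), where b=1, simplified]
  have "(\<integral>y. y i ^ 4 \<partial>dir) = (\<integral>y. refl45 i j y i ^ 4 \<partial>dir)"
    using assms by (subst integral_refl45) auto
  also have i4: "\<dots> = ((\<integral>y. y i ^ 4 \<partial>dir) + (\<integral>y. y j ^ 4 \<partial>dir) + 6 * (\<integral>y. y i ^ 2 * y j ^ 2 \<partial>dir)) / 4"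
    unfolding r4 using odd io by simp
  finally have 1: "(\<integral>y. y i ^ 4 \<partial>dir)
    = ((\<integral>y. y i ^ 4 \<partial>dir) + (\<integral>y. y j ^ 4 \<partial>dir) + 6 * (\<integral>y. y i ^ 2 * y j ^ 2 \<partial>dir)) / 4" .
  have "(\<integral>y. y j ^ 4 \<partial>dir) = (\<integral>y. refl45 i j y j ^ 4 \<partial>dir)"
    using assms by (subst integral_refl45) auto
  also have i4: "\<dots> = ((\<integral>y. y i ^ 4 \<partial>dir) + (\<integral>y. y j ^ 4 \<partial>dir) + 6 * (\<integral>y. y i ^ 2 * y j ^ 2 \<partial>dir)) / 4"
    unfolding r4 using odd io by simp
  finally show 2: "(\<integral>y. y i ^ 4 \<partial>dir) = (\<integral>y. y j ^ 4 \<partial>dir)" using 1 by linarith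
  then show "(\<integral>y. y i ^ 4 \<partial>dir) = 3 * (\<integral>y. y i ^ 2 * y j ^ 2 \<partial>dir)"
    using 1 lin by blast
qed

text \<open>The \<open>p\<close> second moments agree, and they add up to 1 because almost every
  \<open>y\<close> is a unit vector.\<close>

lemma integral_coord_sq:
  assumes "i < p"
  shows "(\<integral>y. y i ^ 2 \<partial>dir) = 1 / p"
proof -
  interpret prob_space dir by (rule prob_space_dir)
  have "1 = (\<integral>y. (1::real) \<partial>dir)" by (simp add: prob_space)
  also have "\<dots> = (\<integral>y. (\<Sum>j<p. y j ^ 2) \<partial>dir)"
    by (rule integral_cong_AE)
       (use AE_dir_unit in \<open>auto elim!: eventually_mono simp: dot_def power2_eq_square
          measurable_cong_sets[OF sets_dir refl]\<close>)
  also have "\<dots> = (\<Sum>j<p. \<integral>y. y j ^ 2 \<partial>dir)"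
    using integrable_dir_coord2[OF _ assms, where b=0] by (subst Bochner_Integration.integral_sum) auto
  also have "\<dots> = (\<Sum>j<p. \<integral>y. y i ^ 2 \<partial>dir)"
    using integral_power_coord(1)[OF assms] by (intro sum.cong refl) (metis lessThan_iff)
  finally show ?thesis using p_ge by (simp add: field_simps)
qed

text \<open>Insert the factor \<open>1 = (\<Sum>j<p. y j ^ 2)\<close> into the second moment. As
  mixed moments are a third of the fourth moment \<open>m\<close>, this reads
  \<open>1 / p = m + (p - 1) * m / 3\<close>.\<close>

lemma integral_coord_4:
  assumes "i < p"
  shows "(\<integral>y. y i ^ 4 \<partial>dir) = 3 / (p * (p + 2))"
proof -
  have "1 / p = (\<integral>y. y i ^ 2 \<partial>dir)" using integral_coord_sq[OF assms] by simp
  also have "\<dots> = (\<integral>y. (\<Sum>j<p. y i ^ 2 * y j ^ 2) \<partial>dir)"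
  proof (rule integral_cong_AE)
    show "AE y in dir. (y i)\<^sup>2 = (\<Sum>j<p. (y i)\<^sup>2 * (y j)\<^sup>2)"
      using AE_dir_unit
    proof eventually_elim
      case (elim y)
      then have "(\<Sum>j<p. (y j)\<^sup>2) = 1" by (simp add: dot_def power2_eq_square)
      then show ?case by (simp add: sum_distrib_left[symmetric])
    qed
  qed (use assms in \<open>auto simp: measurable_cong_sets[OF sets_dir refl]\<close>)
  also have "\<dots> = (\<Sum>j<p. \<integral>y. y i ^ 2 * y j ^ 2 \<partial>dir)"
    using integrable_dir_coord2[OF assms] by (subst Bochner_Integration.integral_sum) auto
  also have "\<dots> = (\<integral>y. y i ^ 4 \<partial>dir) + (\<Sum>j\<in>{..<p} - {i}. \<integral>y. y i ^ 2 * y j ^ 2 \<partial>dir)"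
    using assms by (subst sum.remove[of _ i]) (auto simp: power_add[symmetric])
  also have "(\<Sum>j\<in>{..<p} - {i}. \<integral>y. y i ^ 2 * y j ^ 2 \<partial>dir) = (\<Sum>j\<in>{..<p} - {i}. (\<integral>y. y i ^ 4 \<partial>dir) / 3)"
    using integral_power_coord(3)[OF assms] by (intro sum.cong) auto
  also have "\<dots> = (p - 1) * ((\<integral>y. y i ^ 4 \<partial>dir) / 3)"
    using assms by (simp add: card_Diff_singleton)
  finally have e: "1 / p = (\<integral>y. y i ^ 4 \<partial>dir) * (p + 2) / 3"
    using p_ge by (simp add: of_nat_diff field_simps)
  have lin: "1 / q = a * r / 3 \<Longrightarrow> q > 0 \<Longrightarrow> r > 0 \<Longrightarrow> a = 3 / (q * r)" for a q r :: real
    by (simp add: field_simps)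
  show ?thesis using lin[OF e] p_ge by (simp add: algebra_simps)
qed

lemma integral_dot: "(\<integral>y. dot p w y \<partial>dir) = 0"
proof -
  have "(\<integral>y. dot p w y \<partial>dir) = (\<Sum>i<p. w i * (\<integral>y. y i \<partial>dir))"
    unfolding dot_def
    using integrable_dir_coord2[where a=1 and b=0]
    by (subst Bochner_Integration.integral_sum) auto
  also have "\<dots> = 0"
    using integral_dot_odd[of 0 _ 1 w 0] by simp
  finally show ?thesis .
qed

text \<open>Induction on \<open>m\<close>: a new coordinate adds a cross term that is odd in
  \<open>y m\<close> and vanishes, and \<open>w m ^ 2\<close> times the mixed moment
  \<open>1 / (p * (p + 2))\<close>.\<close>

lemma integral_dot_sq_coord_sq:
  assumes "m \<le> k" "k < p"
  shows "(\<integral>y. dot m w y ^ 2 * y k ^ 2 \<partial>dir) = dot m w w / (p * (p + 2))"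
  using assms(1)
proof (induction m)
  case 0
  then show ?case by (simp add: dot_def)
next
  case (Suc m)
  then have m: "m < p" "m \<noteq> k" "m \<le> p" "m \<le> k" using assms by auto
  have mix: "integrable dir (\<lambda>y. dot m w y * (y m * y k ^ 2))"
  proof (rule integrable_dir_bounded)
    show "(\<lambda>y. dot m w y * (y m * y k ^ 2)) \<in> borel_measurable (RV p)"
      using m assms by (intro borel_measurable_times borel_measurable_power measurable_dot) auto
    fix y :: "nat \<Rightarrow> real"
    assume y: "\<And>i. i < p \<Longrightarrow> \<bar>y i\<bar> \<le> 1"
    have "\<bar>dot m w y\<bar> \<le> (\<Sum>i<m. \<bar>w i\<bar>)"
      unfolding dot_def using m y
      by (intro order_trans[OF sum_abs] sum_mono) (auto simp: abs_mult intro!: mult_left_le)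
    moreover have "\<bar>y m\<bar> * (y k)\<^sup>2 \<le> 1" using y m assms by (intro mult_le_one) (auto simp: abs_square_le_1)
    ultimately have "\<bar>dot m w y\<bar> * (\<bar>y m\<bar> * (y k)\<^sup>2) \<le> (\<Sum>i<m. \<bar>w i\<bar>) * 1"
      by (intro mult_mono) (auto simp: sum_nonneg)
    then show "\<bar>dot m w y * (y m * y k ^ 2)\<bar> \<le> (\<Sum>i<m. \<bar>w i\<bar>)"
      by (simp add: abs_mult)
  qed
  have mix0: "(\<integral>y. dot m w y * (y m * y k ^ 2) \<partial>dir) = 0"
  proof (rule integral_odd[OF m(1)])
    show "(\<lambda>y. dot m w y * (y m * y k ^ 2)) \<in> borel_measurable (RV p)"
      using m assms by (intro borel_measurable_times borel_measurable_power measurable_dot) auto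
    have "dot m w (flip m y) = dot m w y" for y
      unfolding dot_def by (intro sum.cong) (auto simp: flip_def)
    then show "dot m w (flip m y) * (flip m y m * flip m y k ^ 2) = - (dot m w y * (y m * y k ^ 2))" for y
      using m by (simp add: flip_def)
  qed
  have e: "dot (Suc m) w y ^ 2 * y k ^ 2
      = dot m w y ^ 2 * y k ^ 2 + 2 * w m * (dot m w y * (y m * y k ^ 2)) + w m ^ 2 * (y m ^ 2 * y k ^ 2)" for y
    by (simp add: dot_def power2_sum) (simp add: algebra_simps power2_eq_square)
  have "(\<integral>y. y m ^ 2 * y k ^ 2 \<partial>dir) = 1 / (p * (p + 2))"
    using integral_power_coord(3)[OF m(1) assms(2) m(2)] integral_coord_4[OF m(1)] by simp
  then show ?case
    unfolding e using Suc mix mix0 integrable_dir_dot_power[OF m(3) assms(2)] integrable_dir_coord2[OF m(1) assms(2)]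
    by (simp add: add_divide_distrib) (simp add: dot_def power2_eq_square add_divide_distrib)
qed

text \<open>These are the values that a rotation of \<open>w\<close> onto an axis would give. Here
  they come from the binomial expansion in one more coordinate: the odd powers of \<open>y m\<close>
  integrate to zero, and the even ones complete the square
  \<open>(dot m w w + w m ^ 2)\<^sup>2\<close>.\<close>

lemma integral_dot_power:
  assumes "m \<le> p"
  shows "(\<integral>y. dot m w y ^ 2 \<partial>dir) = dot m w w / p"
    and "(\<integral>y. dot m w y ^ 4 \<partial>dir) = 3 * (dot m w w)\<^sup>2 / (p * (p + 2))"
  using assms
proof (induction m)
  case 0
  { case 1 then show ?case by (simp add: dot_def) }
  { case 2 then show ?case by (simp add: dot_def) }
next
  case (Suc m)
  {
    case 1
    then have m: "m < p" "m \<le> p" by auto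
    have e: "dot (Suc m) w y ^ 2 = dot m w y ^ 2 + 2 * w m * (dot m w y * y m) + w m ^ 2 * y m ^ 2" for y
      by (simp add: dot_def power2_sum) (simp add: algebra_simps power2_eq_square)
    note i = integrable_dir_dot_power[OF m(2,1), of w]
    note o = integral_dot_odd[OF order_refl m(1), of _ w]
    show ?case
      unfolding e using Suc.IH(1)[OF m(2)] i[of 2 0] i[of 0 2] i[of 1 1] o[of 1 1] integral_coord_sq[OF m(1)]
      by simp (simp add: dot_def power2_eq_square add_divide_distrib)
  }
  {
    case 2
    then have m: "m < p" "m \<le> p" by auto
    have e: "dot (Suc m) w y ^ 4 = dot m w y ^ 4 + 4 * w m * (dot m w y ^ 3 * y m)
       + 6 * w m ^ 2 * (dot m w y ^ 2 * y m ^ 2) + 4 * w m ^ 3 * (dot m w y * y m ^ 3) + w m ^ 4 * y m ^ 4" for y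
      by (simp add: dot_def) (simp add: algebra_simps power2_eq_square power3_eq_cube power4_eq_xxxx)
    have d: "dot (Suc m) w w = dot m w w + w m ^ 2" by (simp add: dot_def power2_eq_square)
    note i = integrable_dir_dot_power[OF m(2,1), of w]
    note o = integral_dot_odd[OF order_refl m(1), of _ w]
    have "(\<integral>y. dot (Suc m) w y ^ 4 \<partial>dir) = 3 * (dot m w w)\<^sup>2 / (p * (p + 2))
       + 6 * w m ^ 2 * (dot m w w / (p * (p + 2))) + w m ^ 4 * (3 / (p * (p + 2)))"
      unfolding e using Suc.IH(2)[OF m(2)] i[of 4 0] i[of 0 4] i[of 1 3] i[of 3 1] i[of 2 2] o[of 1 3] o[of 3 1]
        integral_coord_4[OF m(1)] integral_dot_sq_coord_sq[OF order_refl m(1), of w]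
      by simp
    also have "\<dots> = 3 * (dot (Suc m) w w)\<^sup>2 / (p * (p + 2))"
      unfolding d by (simp add: power2_sum add_divide_distrib[symmetric] algebra_simps)
    finally show ?case .
  }
qed

end

section \<open>Independent uniform directions\<close>

lemma dot_scale: "dot p (\<lambda>i. c * w i) v = c * dot p w v" "dot p v (\<lambda>i. c * w i) = c * dot p v w"
  by (simp_all add: dot_def sum_distrib_left mult_ac)

lemma dot_sum: "dot p (\<lambda>i. \<Sum>k\<in>K. w k i) v = (\<Sum>k\<in>K. dot p (w k) v)"
  "dot p v (\<lambda>i. \<Sum>k\<in>K. w k i) = (\<Sum>k\<in>K. dot p v (w k))"
  unfolding dot_def sum_distrib_right sum_distrib_left by (rule sum.swap)+

lemma dot_add: "dot p (\<lambda>i. w i + w' i) v = dot p w v + dot p w' v"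
  "dot p v (\<lambda>i. w i + w' i) = dot p v w + dot p v w'"
  by (simp_all add: dot_def sum.distrib algebra_simps)

lemma dot_commute: "dot p w v = dot p v w"
  by (simp add: dot_def mult.commute)

lemma dot_nonneg: "dot p w w \<ge> 0"
  by (simp add: dot_def sum_nonneg)

locale sphere_sample = spherical +
  fixes n :: nat
begin

text \<open>The directions are studied on this canonical product space; \<open>distr_U\<close> shows
  that the directions of a given sample have this joint law.\<close>

definition P :: "(nat \<Rightarrow> nat \<Rightarrow> real) measure" where
  "P = PiM {1..n} (\<lambda>_. dir)"

abbreviation E :: "((nat \<Rightarrow> nat \<Rightarrow> real) \<Rightarrow> real) \<Rightarrow> real" where
  "E f \<equiv> (\<integral>x. f x \<partial>P)"

lemma prob_space_P: "prob_space P"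
  unfolding P_def by (rule prob_space_PiM) (rule prob_space_dir)

sublocale sample: prob_space P by (rule prob_space_P)

declare sample.prob_space [simp]

lemma AE_P_unit: "AE x in P. \<forall>k\<in>{1..n}. dot p (x k) (x k) = 1"
proof (rule eventually_ball_finite)
  show "\<forall>k\<in>{1..n}. AE x in P. dot p (x k) (x k) = 1"
    unfolding P_def using AE_PiM_component[of "{1..n}" "\<lambda>_. dir"] prob_space_dir AE_dir_unit by blast
qed simp

text \<open>Random variables that are bounded where all coordinates lie in \<open>[-1, 1]\<close>, an event of
  probability one. The class is closed under all operations below, so integrability never has to be
  checked by hand.\<close>
definition adm :: "((nat \<Rightarrow> nat \<Rightarrow> real) \<Rightarrow> real) \<Rightarrow> bool" where
  "adm f \<longleftrightarrow> f \<in> borel_measurable P \<and>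
     (\<exists>C. \<forall>x. (\<forall>k\<in>{1..n}. \<forall>i<p. \<bar>x k i\<bar> \<le> 1) \<longrightarrow> \<bar>f x\<bar> \<le> C)"

lemma admI:
  assumes "f \<in> borel_measurable P" "\<And>x. (\<And>k i. k \<in> {1..n} \<Longrightarrow> i < p \<Longrightarrow> \<bar>x k i\<bar> \<le> 1) \<Longrightarrow> \<bar>f x\<bar> \<le> C"
  shows "adm f"
  using assms unfolding adm_def by blast

lemma adm_measurable: "adm f \<Longrightarrow> f \<in> borel_measurable P"
  by (simp add: adm_def)

lemma admE:
  assumes "adm f"
  obtains C where "f \<in> borel_measurable P"
    "\<And>x. (\<And>k i. k \<in> {1..n} \<Longrightarrow> i < p \<Longrightarrow> \<bar>x k i\<bar> \<le> 1) \<Longrightarrow> \<bar>f x\<bar> \<le> C"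
  using assms unfolding adm_def by blast

lemma integrable_adm: "adm f \<Longrightarrow> integrable P f"
proof (erule admE)
  fix C assume f: "f \<in> borel_measurable P"
    and C: "\<And>x. (\<And>k i. k \<in> {1..n} \<Longrightarrow> i < p \<Longrightarrow> \<bar>x k i\<bar> \<le> 1) \<Longrightarrow> \<bar>f x\<bar> \<le> C"
  show "integrable P f"
    using f by (intro sample.integrable_const_bound[where B=C])
      (use AE_P_unit in \<open>auto elim!: eventually_mono intro!: C coord_le_1\<close>)
qed

named_theorems adm_intros

lemma adm_const [adm_intros]: "adm (\<lambda>_. c)"
  by (rule admI[where C="\<bar>c\<bar>"]) auto

lemma adm_coord [adm_intros]:
  assumes "k \<in> {1..n}" "i < p" shows "adm (\<lambda>x. x k i)"
proof (rule admI[where C=1])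
  have "(\<lambda>x. x k) \<in> measurable P dir"
    unfolding P_def using assms by (intro measurable_component_singleton) auto
  then show "(\<lambda>x. x k i) \<in> borel_measurable P"
    using measurable_compose[OF _ measurable_RV_component[OF assms(2)]]
    by (auto simp: measurable_cong_sets[OF refl sets_dir])
qed (use assms in auto)

lemma adm_add [adm_intros]:
  assumes "adm f" "adm g" shows "adm (\<lambda>x. f x + g x)"
proof -
  from assms(1) obtain C where C: "f \<in> borel_measurable P"
    "\<And>x. (\<And>k i. k \<in> {1..n} \<Longrightarrow> i < p \<Longrightarrow> \<bar>x k i\<bar> \<le> 1) \<Longrightarrow> \<bar>f x\<bar> \<le> C" by (elim admE) blast
  from assms(2) obtain D where D: "g \<in> borel_measurable P"
    "\<And>x. (\<And>k i. k \<in> {1..n} \<Longrightarrow> i < p \<Longrightarrow> \<bar>x k i\<bar> \<le> 1) \<Longrightarrow> \<bar>g x\<bar> \<le> D" by (elim admE) blast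
  show ?thesis
    using C D by (intro admI[where C="C + D"]) (auto intro: order_trans[OF abs_triangle_ineq] add_mono)
qed

lemma adm_mult [adm_intros]:
  assumes "adm f" "adm g" shows "adm (\<lambda>x. f x * g x)"
proof -
  from assms(1) obtain C where C: "f \<in> borel_measurable P"
    "\<And>x. (\<And>k i. k \<in> {1..n} \<Longrightarrow> i < p \<Longrightarrow> \<bar>x k i\<bar> \<le> 1) \<Longrightarrow> \<bar>f x\<bar> \<le> C" by (elim admE) blast
  from assms(2) obtain D where D: "g \<in> borel_measurable P"
    "\<And>x. (\<And>k i. k \<in> {1..n} \<Longrightarrow> i < p \<Longrightarrow> \<bar>x k i\<bar> \<le> 1) \<Longrightarrow> \<bar>g x\<bar> \<le> D" by (elim admE) blast
  show ?thesis
  proof (rule admI[where C="C * D"])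
    fix x :: "nat \<Rightarrow> nat \<Rightarrow> real"
    assume x: "\<And>k i. k \<in> {1..n} \<Longrightarrow> i < p \<Longrightarrow> \<bar>x k i\<bar> \<le> 1"
    have "\<bar>f x\<bar> \<le> C" "\<bar>g x\<bar> \<le> D" using C(2) D(2) x by auto
    then show "\<bar>f x * g x\<bar> \<le> C * D" unfolding abs_mult by (intro mult_mono) auto
  qed (use C D in auto)
qed

lemma adm_diff [adm_intros]: "adm f \<Longrightarrow> adm g \<Longrightarrow> adm (\<lambda>x. f x - g x)"
  using adm_add[OF _ adm_mult[OF adm_const[of "-1"]], of f g] by simp

lemma adm_divide [adm_intros]: "adm f \<Longrightarrow> adm (\<lambda>x. f x / c)"
  using adm_mult[OF adm_const[of "1 / c"], of f] by simp

lemma adm_sum [adm_intros]: "(\<And>k. k \<in> K \<Longrightarrow> adm (f k)) \<Longrightarrow> adm (\<lambda>x. \<Sum>k\<in>K. f k x)"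
  by (induction K rule: infinite_finite_induct) (auto intro: adm_intros)

lemma adm_power [adm_intros]: "adm f \<Longrightarrow> adm (\<lambda>x. f x ^ a)"
  by (induction a) (auto intro: adm_intros)

lemma adm_dot [adm_intros]:
  "(\<And>i. i < p \<Longrightarrow> adm (\<lambda>x. F x i)) \<Longrightarrow> (\<And>i. i < p \<Longrightarrow> adm (\<lambda>x. G x i)) \<Longrightarrow> adm (\<lambda>x. dot p (F x) (G x))"
  unfolding dot_def by (intro adm_intros) auto

lemma adm_cos [adm_intros]: "adm f \<Longrightarrow> adm (\<lambda>x. cos (f x))"
  by (rule admI[where C=1]) (auto dest!: adm_measurable)

lemma adm_sin [adm_intros]: "adm f \<Longrightarrow> adm (\<lambda>x. sin (f x))"
  by (rule admI[where C=1]) (auto dest!: adm_measurable)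

lemma adm_abs [adm_intros]: "adm f \<Longrightarrow> adm (\<lambda>x. \<bar>f x\<bar>)"
  unfolding adm_def by auto

lemma E_const [simp]: "E (\<lambda>_. c) = c"
  by simp

lemma E_add: "adm f \<Longrightarrow> adm g \<Longrightarrow> E (\<lambda>x. f x + g x) = E f + E g"
  by (intro Bochner_Integration.integral_add integrable_adm)

lemma E_diff: "adm f \<Longrightarrow> adm g \<Longrightarrow> E (\<lambda>x. f x - g x) = E f - E g"
  by (intro Bochner_Integration.integral_diff integrable_adm)

lemma E_sum: "(\<And>k. k \<in> K \<Longrightarrow> adm (f k)) \<Longrightarrow> E (\<lambda>x. \<Sum>k\<in>K. f k x) = (\<Sum>k\<in>K. E (f k))"
  by (intro Bochner_Integration.integral_sum integrable_adm)

lemma E_mono_unit: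
  assumes "adm f" "adm g" "\<And>x. (\<And>k. k \<in> {1..n} \<Longrightarrow> dot p (x k) (x k) = 1) \<Longrightarrow> f x \<le> g x"
  shows "E f \<le> E g"
  using assms AE_P_unit by (intro integral_mono_AE integrable_adm) (auto elim!: eventually_mono)

lemma E_cong_unit:
  assumes "adm f" "adm g" "\<And>x. (\<And>k. k \<in> {1..n} \<Longrightarrow> dot p (x k) (x k) = 1) \<Longrightarrow> f x = g x"
  shows "E f = E g"
  using assms by (intro antisym E_mono_unit) (auto intro: order.eq_iff[THEN iffD1, THEN conjunct1])

lemma E_mono: "adm f \<Longrightarrow> adm g \<Longrightarrow> (\<And>x. f x \<le> g x) \<Longrightarrow> E f \<le> E g"
  by (rule E_mono_unit)

lemma E_nonneg: "(\<And>x. f x \<ge> 0) \<Longrightarrow> E f \<ge> 0"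
  by (rule Bochner_Integration.integral_nonneg) auto

lemma abs_E_le: "adm f \<Longrightarrow> \<bar>E f\<bar> \<le> E (\<lambda>x. \<bar>f x\<bar>)"
  by (rule integral_abs_bound)

text \<open>Cauchy-Schwarz in terms of given bounds on the second moments, integrated from a
  pointwise weighted inequality between arithmetic and geometric mean. The weights
  \<open>b / a\<close> and \<open>a / b\<close> make both contributions equal.\<close>

lemma E_mult_le:
  assumes f: "adm f" "E (\<lambda>x. (f x)\<^sup>2) \<le> a\<^sup>2" "a > 0" and g: "adm g" "E (\<lambda>x. (g x)\<^sup>2) \<le> b\<^sup>2" "b > 0"
  shows "E (\<lambda>x. f x * g x) \<le> a * b"
proof -
  have le: "u * v \<le> (b / a * u\<^sup>2 + a / b * v\<^sup>2) / 2" for u v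
  proof -
    have "0 \<le> (b * u - a * v)\<^sup>2" by simp
    then have "2 * (a * b) * (u * v) \<le> b\<^sup>2 * u\<^sup>2 + a\<^sup>2 * v\<^sup>2"
      by (simp add: power2_diff power_mult_distrib algebra_simps)
    then show ?thesis using f(3) g(3) by (simp add: field_simps power2_eq_square)
  qed
  have "E (\<lambda>x. f x * g x) \<le> E (\<lambda>x. (b / a * (f x)\<^sup>2 + a / b * (g x)\<^sup>2) / 2)"
    by (intro E_mono adm_intros f g le)
  also have "\<dots> = (b / a * E (\<lambda>x. (f x)\<^sup>2) + a / b * E (\<lambda>x. (g x)\<^sup>2)) / 2"
    using f g by (simp add: E_add adm_intros)
  also have "\<dots> \<le> (b / a * a\<^sup>2 + a / b * b\<^sup>2) / 2"
    using f g by (intro divide_right_mono add_mono mult_left_mono) auto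
  also have "\<dots> = a * b" using f g by (simp add: field_simps power2_eq_square)
  finally show ?thesis .
qed

lemma E_abs_le:
  assumes "adm f" "E (\<lambda>x. (f x)\<^sup>2) \<le> a\<^sup>2" "a > 0"
  shows "E (\<lambda>x. \<bar>f x\<bar>) \<le> a"
  using E_mult_le[of "\<lambda>x. \<bar>f x\<bar>" a "\<lambda>_. 1" 1] assms by (simp add: adm_intros)

text \<open>Stands in for measurability with respect to the vectors other than the
  \<open>k\<close>-th, so that no sigma-algebras or conditional expectations appear.\<close>

definition free_of :: "nat \<Rightarrow> ((nat \<Rightarrow> nat \<Rightarrow> real) \<Rightarrow> 'b) \<Rightarrow> bool" where
  "free_of k f \<longleftrightarrow> (\<forall>x y. f (x(k := y)) = f x)"

text \<open>The tower property: \<open>g\<close> is the conditional expectation of \<open>f\<close>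
  given all vectors but the \<open>k\<close>-th, by Fubini with factor \<open>k\<close>
  innermost.\<close>

lemma E_resample:
  assumes k: "k \<in> {1..n}" and f: "adm f" and g: "adm g" "free_of k g"
    and eq: "\<And>x. (\<integral>y. f (x(k := y)) \<partial>dir) = g x"
  shows "E f = E g"
proof -
  interpret product_sigma_finite "\<lambda>_. dir"
    by (intro product_sigma_finite.intro prob_space_imp_sigma_finite prob_space_dir)
  interpret d: prob_space dir by (rule prob_space_dir)
  define J where "J = {1..n} - {k}"
  have J: "finite J" "k \<notin> J" "insert k J = {1..n}" using k by (auto simp: J_def)
  have fold: "E h = (\<integral>x. (\<integral>y. h (x(k := y)) \<partial>dir) \<partial>PiM J (\<lambda>_. dir))" if "adm h" for h
    using product_integral_insert[OF J(1,2), of h] integrable_adm[OF that] by (simp add: P_def J(3))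
  show ?thesis
    using g(2) by (simp add: fold f g eq free_of_def d.prob_space)
qed

text \<open>With \<open>F\<close> and \<open>G\<close> free of \<open>k\<close>, the factor
  \<open>dot p (F x) (x k)\<close> acts as a martingale difference: its conditional mean given the
  other vectors is zero. The next two lemmas use its conditional variance and fourth moment.\<close>

lemma E_linear:
  assumes k: "k \<in> {1..n}" and G: "adm G" "free_of k G" and F: "\<And>i. i < p \<Longrightarrow> adm (\<lambda>x. F x i)" "free_of k F"
  shows "E (\<lambda>x. G x * dot p (F x) (x k)) = 0"
proof -
  have "E (\<lambda>x. G x * dot p (F x) (x k)) = E (\<lambda>_. 0)"
    by (rule E_resample[OF k])
       (use G F k in \<open>auto simp: free_of_def integral_dot intro!: adm_intros\<close>)
  then show ?thesis by simp
qed

lemma E_square: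
  assumes k: "k \<in> {1..n}" and G: "adm G" "free_of k G" and F: "\<And>i. i < p \<Longrightarrow> adm (\<lambda>x. F x i)" "free_of k F"
  shows "E (\<lambda>x. G x * (dot p (F x) (x k))\<^sup>2) = E (\<lambda>x. G x * dot p (F x) (F x)) / p"
proof -
  have "E (\<lambda>x. G x * (dot p (F x) (x k))\<^sup>2) = E (\<lambda>x. G x * dot p (F x) (F x) / p)"
    by (rule E_resample[OF k])
       (use G F k in \<open>auto simp: free_of_def integral_dot_power intro!: adm_intros\<close>)
  then show ?thesis by simp
qed

lemma E_fourth:
  assumes k: "k \<in> {1..n}" and F: "\<And>i. i < p \<Longrightarrow> adm (\<lambda>x. F x i)" "free_of k F"
  shows "E (\<lambda>x. dot p (F x) (x k) ^ 4) \<le> 3 / (real p)\<^sup>2 * E (\<lambda>x. (dot p (F x) (F x))\<^sup>2)"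
proof -
  have "E (\<lambda>x. dot p (F x) (x k) ^ 4) = E (\<lambda>x. 3 * (dot p (F x) (F x))\<^sup>2 / (p * (p + 2)))"
    by (rule E_resample[OF k])
       (use F k in \<open>auto simp: free_of_def integral_dot_power intro!: adm_intros\<close>)
  also have "\<dots> = 3 / (p * (p + 2)) * E (\<lambda>x. (dot p (F x) (F x))\<^sup>2)" by simp
  \<comment> \<open>Weakening \<open>p * (p + 2)\<close> to \<open>p\<^sup>2\<close> leaves the
    ratio 3 between fourth moment and squared variance, as for a normal variable.\<close>
  also have "\<dots> \<le> 3 / (real p)\<^sup>2 * E (\<lambda>x. (dot p (F x) (F x))\<^sup>2)"
    using p_ge by (intro mult_right_mono divide_left_mono E_nonneg)
      (auto simp: power2_eq_square intro!: mult_left_mono mult_pos_pos add_pos_pos)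
  finally show ?thesis .
qed

lemma E_dot_pair:
  assumes "j \<in> {1..n}" "k \<in> {1..n}" "j \<noteq> k"
  shows "E (\<lambda>x. (dot p (x j) (x k))\<^sup>2) = 1 / p"
    and "E (\<lambda>x. dot p (x j) (x k) ^ 4) \<le> 3 / (real p)\<^sup>2"
proof -
  have F: "\<And>i. i < p \<Longrightarrow> adm (\<lambda>x. x j i)" "free_of k (\<lambda>x. x j)"
    using assms by (auto intro!: adm_intros simp: free_of_def)
  have "E (\<lambda>x. dot p (x j) (x j)) = E (\<lambda>_. 1)"
    using assms by (intro E_cong_unit adm_intros) auto
  moreover have "E (\<lambda>x. (dot p (x j) (x j))\<^sup>2) = E (\<lambda>_. 1)"
    using assms by (intro E_cong_unit adm_intros) auto
  ultimately show "E (\<lambda>x. (dot p (x j) (x k))\<^sup>2) = 1 / p"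
    "E (\<lambda>x. dot p (x j) (x k) ^ 4) \<le> 3 / (real p)\<^sup>2"
    using E_square[OF assms(2) adm_const[of 1] _ F] E_fourth[OF assms(2) F] by (auto simp: free_of_def)
qed

text \<open>Orthogonality of martingale differences: when the largest index \<open>k\<close> joins
  \<open>K\<close>, all earlier terms are free of \<open>k\<close>, and the cross term vanishes by
  \<open>E_linear\<close>.\<close>

lemma E_square_sum:
  assumes K: "K \<subseteq> {1..n}" and F: "\<And>k i. k \<in> K \<Longrightarrow> i < p \<Longrightarrow> adm (\<lambda>x. F k x i)"
    and free: "\<And>k l. k \<in> K \<Longrightarrow> l \<in> K \<Longrightarrow> l \<le> k \<Longrightarrow> free_of k (F l)"
  shows "E (\<lambda>x. (\<Sum>k\<in>K. dot p (F k x) (x k))\<^sup>2) = (\<Sum>k\<in>K. E (\<lambda>x. dot p (F k x) (F k x))) / p"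
proof -
  have "finite K" using K finite_subset by blast
  then show ?thesis using K F free
  proof (induction K rule: finite_linorder_max_induct)
    case empty
    then show ?case by simp
  next
    case (insert k K)
    let ?S = "\<lambda>x. \<Sum>l\<in>K. dot p (F l x) (x l)"
    have k: "k \<in> {1..n}" "k \<notin> K" using insert by auto
    have aS: "adm ?S" using insert.prems by (intro adm_intros) auto
    have fS: "free_of k ?S"
      unfolding free_of_def
    proof (intro allI sum.cong refl)
      fix x y l assume l: "l \<in> K"
      then have "F l (x(k := y)) = F l x" "l \<noteq> k"
        using insert.prems(3)[of k l] insert.hyps by (auto simp: free_of_def)
      then show "dot p (F l (x(k := y))) ((x(k := y)) l) = dot p (F l x) (x l)" by simp
    qed
    have Fk: "\<And>i. i < p \<Longrightarrow> adm (\<lambda>x. F k x i)" "free_of k (F k)" using insert.prems by auto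
    have "E (\<lambda>x. (\<Sum>l\<in>insert k K. dot p (F l x) (x l))\<^sup>2)
        = E (\<lambda>x. 1 * (dot p (F k x) (x k))\<^sup>2 + 2 * (?S x * dot p (F k x) (x k)) + (?S x)\<^sup>2)"
      using k insert.hyps by (simp add: power2_sum algebra_simps)
    also have "\<dots> = E (\<lambda>x. 1 * (dot p (F k x) (x k))\<^sup>2) + 2 * E (\<lambda>x. ?S x * dot p (F k x) (x k)) + E (\<lambda>x. (?S x)\<^sup>2)"
      using k aS Fk by (subst E_add, auto intro!: adm_intros)+
    also have "\<dots> = E (\<lambda>x. dot p (F k x) (F k x)) / p + E (\<lambda>x. (?S x)\<^sup>2)"
      using E_linear[OF k(1) aS fS Fk] E_square[OF k(1) adm_const[of 1] _ Fk] by (simp add: free_of_def)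
    finally show ?case
      using insert k by (simp add: add_divide_distrib)
  qed
qed

end

section \<open>A Lindeberg-type telescoping bound\<close>

text \<open>The order-two expansion of \<open>iexp d\<close>, rotated by \<open>cis a\<close>, has
  this error as its real part. Rotation keeps the modulus, so the bound is uniform in
  \<open>a\<close>.\<close>

lemma cos_taylor2:
  fixes a d :: real
  shows "\<bar>cos (a + d) - (cos a - d * sin a - d\<^sup>2 / 2 * cos a)\<bar> \<le> \<bar>d\<bar> ^ 3 / 6"
proof -
  have "iexp d - (\<Sum>k\<le>2. (\<i> * d) ^ k / fact k) = Complex (cos d - 1 + d\<^sup>2 / 2) (sin d - d)"
    by (simp add: complex_eq_iff Re_exp Im_exp eval_nat_numeral)
  then have "cmod (Complex (cos d - 1 + d\<^sup>2 / 2) (sin d - d)) \<le> \<bar>d\<bar> ^ 3 / 6"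
    using iexp_approx1[of d 2] by (simp add: eval_nat_numeral)
  moreover have "cos (a + d) - (cos a - d * sin a - d\<^sup>2 / 2 * cos a)
      = Re (cis a * Complex (cos d - 1 + d\<^sup>2 / 2) (sin d - d))"
    by (simp add: cos_add algebra_simps)
  ultimately show ?thesis
    using abs_Re_le_cmod[of "cis a * Complex (cos d - 1 + d\<^sup>2 / 2) (sin d - d)"]
    by (simp add: norm_mult)
qed

lemma exp_minus_taylor1:
  fixes x :: real
  assumes "x \<ge> 0"
  shows "\<bar>1 - x - exp (- x)\<bar> \<le> x\<^sup>2 / 2"
proof -
  have "1 - x \<le> exp (-x)" using exp_ge_add_one_self[of "-x"] by simp
  moreover have "exp (-x) \<le> 1 - x + x\<^sup>2 / 2"
  proof -
    let ?f = "\<lambda>x::real. 1 - x + x\<^sup>2 / 2 - exp (-x)"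
    have "?f 0 \<le> ?f x"
    proof (rule DERIV_nonneg_imp_nondecreasing[OF assms])
      fix y :: real
      assume "0 \<le> y"
      have "(?f has_real_derivative (- 1 + y + exp (-y))) (at y)"
        by (auto intro!: derivative_eq_intros)
      moreover have "- 1 + y + exp (-y) \<ge> 0" using exp_ge_add_one_self[of "-y"] by simp
      ultimately show "\<exists>z. (?f has_real_derivative z) (at y) \<and> 0 \<le> z" by blast
    qed
    then show ?thesis by simp
  qed
  ultimately show ?thesis by (simp add: abs_if)
qed

text \<open>Only even moments of the differences are at hand, so the cubic Taylor remainder is
  traded for second and fourth moments, with a weight \<open>\<eta>\<close> to be chosen
  later.\<close>

lemma abs_cube_le:
  fixes d \<eta> :: real
  assumes "\<eta> > 0"
  shows "\<bar>d\<bar> ^ 3 \<le> (\<eta> * d\<^sup>2 + d ^ 4 / \<eta>) / 2"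
proof -
  have "0 \<le> (d\<^sup>2 * (\<bar>d\<bar> - \<eta>)\<^sup>2)" by simp
  also have "\<dots> = d ^ 4 - 2 * \<eta> * \<bar>d\<bar> ^ 3 + \<eta>\<^sup>2 * d\<^sup>2"
    by (cases "d \<ge> 0") (auto simp: power2_eq_square power3_eq_cube power4_eq_xxxx algebra_simps)
  finally show ?thesis using assms by (simp add: field_simps power2_eq_square)
qed

context sphere_sample
begin

text \<open>Expand the cosine around \<open>A x\<close>. The linear term has mean zero, and the
  quadratic one turns the squared product into \<open>dot p (F x) (F x) / p\<close>. The three
  errors come from replacing this conditional variance by the constant \<open>\<delta>\<close>, from
  the Taylor remainder, and from replacing \<open>1 - u\<^sup>2 * \<delta> / 2\<close> by the
  exponential.\<close>

lemma E_cos_step: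
  assumes t: "t \<in> {1..n}" and A: "adm A" "free_of t A"
    and F: "\<And>i. i < p \<Longrightarrow> adm (\<lambda>x. F x i)" "free_of t F" and \<eta>: "\<eta> > 0" and \<delta>: "\<delta> \<ge> 0"
  shows "\<bar>E (\<lambda>x. cos (A x + u * dot p (F x) (x t))) - exp (- (u\<^sup>2 * \<delta> / 2)) * E (\<lambda>x. cos (A x))\<bar>
    \<le> u\<^sup>2 / 2 * E (\<lambda>x. \<bar>dot p (F x) (F x) / p - \<delta>\<bar>)
      + \<bar>u\<bar> ^ 3 / 12 * (\<eta> * E (\<lambda>x. (dot p (F x) (x t))\<^sup>2) + E (\<lambda>x. dot p (F x) (x t) ^ 4) / \<eta>)
      + u ^ 4 * \<delta>\<^sup>2 / 8"
proof -
  let ?D = "\<lambda>x. dot p (F x) (x t)"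
  have aD: "adm ?D" using F t by (intro adm_intros) auto
  have aF: "adm (\<lambda>x. dot p (F x) (F x))" using F by (intro adm_intros) auto
  have fc: "free_of t (\<lambda>x. cos (A x))" "free_of t (\<lambda>x. sin (A x))" using A by (auto simp: free_of_def)
  note ai = adm_intros aD aF A(1)
  define err where "err x = cos (A x + u * ?D x) - (cos (A x) - u * ?D x * sin (A x) - (u * ?D x)\<^sup>2 / 2 * cos (A x))" for x
  have aerr: "adm err" unfolding err_def by (intro ai)
  have "\<bar>E err\<bar> \<le> E (\<lambda>x. \<bar>err x\<bar>)" by (rule abs_E_le[OF aerr])
  also have "\<dots> \<le> E (\<lambda>x. \<bar>u\<bar> ^ 3 / 12 * (\<eta> * (?D x)\<^sup>2 + ?D x ^ 4 / \<eta>))"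
  proof (rule E_mono)
    show "adm (\<lambda>x. \<bar>err x\<bar>)" by (intro ai aerr)
    show "adm (\<lambda>x. \<bar>u\<bar> ^ 3 / 12 * (\<eta> * (?D x)\<^sup>2 + ?D x ^ 4 / \<eta>))" by (intro ai)
    fix x
    have "\<bar>err x\<bar> \<le> \<bar>u * ?D x\<bar> ^ 3 / 6" unfolding err_def by (rule cos_taylor2)
    also have "\<dots> = \<bar>u\<bar> ^ 3 / 6 * \<bar>?D x\<bar> ^ 3" by (simp add: abs_mult power_mult_distrib)
    also have "\<dots> \<le> \<bar>u\<bar> ^ 3 / 6 * ((\<eta> * (?D x)\<^sup>2 + ?D x ^ 4 / \<eta>) / 2)"
      by (intro mult_left_mono abs_cube_le \<eta>) auto
    finally show "\<bar>err x\<bar> \<le> \<bar>u\<bar> ^ 3 / 12 * (\<eta> * (?D x)\<^sup>2 + ?D x ^ 4 / \<eta>)" by simp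
  qed
  also have "\<dots> = \<bar>u\<bar> ^ 3 / 12 * (\<eta> * E (\<lambda>x. (?D x)\<^sup>2) + E (\<lambda>x. ?D x ^ 4) / \<eta>)"
    by (simp add: E_add ai)
  finally have 1: "\<bar>E err\<bar> \<le> \<bar>u\<bar> ^ 3 / 12 * (\<eta> * E (\<lambda>x. (?D x)\<^sup>2) + E (\<lambda>x. ?D x ^ 4) / \<eta>)" .
  have "E (\<lambda>x. cos (A x + u * ?D x))
      = E (\<lambda>x. ((err x + cos (A x)) - u * (sin (A x) * ?D x)) - u\<^sup>2 / 2 * (cos (A x) * (?D x)\<^sup>2))"
    by (intro Bochner_Integration.integral_cong refl) (simp add: err_def power_mult_distrib algebra_simps)
  also have "\<dots> = E err + E (\<lambda>x. cos (A x)) - u * E (\<lambda>x. sin (A x) * ?D x) - u\<^sup>2 / 2 * E (\<lambda>x. cos (A x) * (?D x)\<^sup>2)"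
    by (simp only: E_diff E_add ai aerr Bochner_Integration.integral_mult_right_zero)
  also have "\<dots> = E err + E (\<lambda>x. cos (A x)) - u\<^sup>2 / 2 * (E (\<lambda>x. cos (A x) * dot p (F x) (F x)) / p)"
    using E_linear[OF t adm_sin[OF A(1)] fc(2) F] E_square[OF t adm_cos[OF A(1)] fc(1) F] by simp
  also have "E (\<lambda>x. cos (A x) * dot p (F x) (F x)) / p
      = E (\<lambda>x. cos (A x) * (dot p (F x) (F x) / p - \<delta>) + \<delta> * cos (A x))"
    by (subst integral_divide_zero[symmetric])
       (intro Bochner_Integration.integral_cong refl, simp add: algebra_simps)
  also have "\<dots> = E (\<lambda>x. cos (A x) * (dot p (F x) (F x) / p - \<delta>)) + \<delta> * E (\<lambda>x. cos (A x))"
    by (simp only: E_add ai Bochner_Integration.integral_mult_right_zero)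
  finally have 2: "E (\<lambda>x. cos (A x + u * ?D x)) = E err - u\<^sup>2 / 2 * E (\<lambda>x. cos (A x) * (dot p (F x) (F x) / p - \<delta>))
      + (1 - u\<^sup>2 * \<delta> / 2) * E (\<lambda>x. cos (A x))" by (simp add: algebra_simps)
  have "\<bar>E (\<lambda>x. cos (A x) * (dot p (F x) (F x) / p - \<delta>))\<bar> \<le> E (\<lambda>x. \<bar>cos (A x) * (dot p (F x) (F x) / p - \<delta>)\<bar>)"
    by (intro abs_E_le ai)
  also have "\<dots> \<le> E (\<lambda>x. \<bar>dot p (F x) (F x) / p - \<delta>\<bar>)"
    by (intro E_mono ai) (auto simp: abs_mult intro!: mult_left_le_one_le)
  finally have 3: "\<bar>u\<^sup>2 / 2 * E (\<lambda>x. cos (A x) * (dot p (F x) (F x) / p - \<delta>))\<bar>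
      \<le> u\<^sup>2 / 2 * E (\<lambda>x. \<bar>dot p (F x) (F x) / p - \<delta>\<bar>)"
    by (simp add: abs_mult mult_left_mono)
  have "\<bar>E (\<lambda>x. cos (A x))\<bar> \<le> E (\<lambda>x. \<bar>cos (A x)\<bar>)" by (intro abs_E_le ai)
  also have "\<dots> \<le> E (\<lambda>_. 1)" by (intro E_mono ai) auto
  finally have c1: "\<bar>E (\<lambda>x. cos (A x))\<bar> \<le> 1" by simp
  have "\<bar>1 - u\<^sup>2 * \<delta> / 2 - exp (- (u\<^sup>2 * \<delta> / 2))\<bar> \<le> (u\<^sup>2 * \<delta> / 2)\<^sup>2 / 2"
    using \<delta> by (intro exp_minus_taylor1) auto
  also have "\<dots> = u ^ 4 * \<delta>\<^sup>2 / 8" by (simp add: power2_eq_square power4_eq_xxxx)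
  finally have "\<bar>1 - u\<^sup>2 * \<delta> / 2 - exp (- (u\<^sup>2 * \<delta> / 2))\<bar> * \<bar>E (\<lambda>x. cos (A x))\<bar> \<le> u ^ 4 * \<delta>\<^sup>2 / 8 * 1"
    using c1 by (intro mult_mono) auto
  then have 4: "\<bar>(1 - u\<^sup>2 * \<delta> / 2 - exp (- (u\<^sup>2 * \<delta> / 2))) * E (\<lambda>x. cos (A x))\<bar> \<le> u ^ 4 * \<delta>\<^sup>2 / 8"
    by (simp add: abs_mult)
  have "E (\<lambda>x. cos (A x + u * ?D x)) - exp (- (u\<^sup>2 * \<delta> / 2)) * E (\<lambda>x. cos (A x))
    = E err - u\<^sup>2 / 2 * E (\<lambda>x. cos (A x) * (dot p (F x) (F x) / p - \<delta>))
      + (1 - u\<^sup>2 * \<delta> / 2 - exp (- (u\<^sup>2 * \<delta> / 2))) * E (\<lambda>x. cos (A x))"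
    unfolding 2 by (simp add: algebra_simps)
  then show ?thesis using 1 3 4 by linarith
qed

text \<open>One application of \<open>E_cos_step\<close> per time index, starting from
  \<open>cos \<theta>\<close> for the empty sum. The phase \<open>\<theta>\<close> is kept free
  because its two values 0 and \<open>- pi / 2\<close> later give both parts of the characteristic
  function.\<close>

lemma E_cos_martingale:
  assumes F: "\<And>t i. t \<in> {1..n} \<Longrightarrow> i < p \<Longrightarrow> adm (\<lambda>x. F t x i)"
    and free: "\<And>t k. t \<in> {1..n} \<Longrightarrow> t \<le> k \<Longrightarrow> free_of k (F t)"
    and \<eta>: "\<eta> > 0" and \<delta>: "\<And>t. t \<in> {1..n} \<Longrightarrow> 0 \<le> \<delta> t \<and> \<delta> t \<le> d"
    and e1: "\<And>t. t \<in> {1..n} \<Longrightarrow> E (\<lambda>x. \<bar>dot p (F t x) (F t x) / p - \<delta> t\<bar>) \<le> e1"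
    and e2: "\<And>t. t \<in> {1..n} \<Longrightarrow> E (\<lambda>x. (dot p (F t x) (x t))\<^sup>2) \<le> e2"
    and e4: "\<And>t. t \<in> {1..n} \<Longrightarrow> E (\<lambda>x. dot p (F t x) (x t) ^ 4) \<le> e4"
  shows "\<bar>E (\<lambda>x. cos (\<theta> + u * (\<Sum>t\<in>{1..n}. dot p (F t x) (x t)))) - exp (- (u\<^sup>2 * (\<Sum>t\<in>{1..n}. \<delta> t) / 2)) * cos \<theta>\<bar>
    \<le> real n * (u\<^sup>2 / 2 * e1 + \<bar>u\<bar> ^ 3 / 12 * (\<eta> * e2 + e4 / \<eta>) + u ^ 4 * d\<^sup>2 / 8)"
proof -
  define e where "e = u\<^sup>2 / 2 * e1 + \<bar>u\<bar> ^ 3 / 12 * (\<eta> * e2 + e4 / \<eta>) + u ^ 4 * d\<^sup>2 / 8"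
  have "\<bar>E (\<lambda>x. cos (\<theta> + u * (\<Sum>t\<in>{1..m}. dot p (F t x) (x t)))) - exp (- (u\<^sup>2 * (\<Sum>t\<in>{1..m}. \<delta> t) / 2)) * cos \<theta>\<bar>
    \<le> real m * e" if "m \<le> n" for m
    using that
  proof (induction m)
    case 0
    then show ?case by simp
  next
    case (Suc m)
    define A where "A x = \<theta> + u * (\<Sum>t\<in>{1..m}. dot p (F t x) (x t))" for x
    let ?t = "Suc m"
    have t: "?t \<in> {1..n}" using Suc by simp
    have aA: "adm A" unfolding A_def using Suc F by (intro adm_intros) auto
    have fA: "free_of ?t A" unfolding free_of_def
    proof (intro allI)
      fix x :: "nat \<Rightarrow> nat \<Rightarrow> real" and y
      have "F k (x(?t := y)) = F k x" if "k \<in> {1..m}" for k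
        using free[of k ?t] that Suc.prems by (auto simp: free_of_def)
      then show "A (x(?t := y)) = A x" by (auto simp: A_def intro!: sum.cong)
    qed
    have st: "\<bar>E (\<lambda>x. cos (A x + u * dot p (F ?t x) (x ?t))) - exp (- (u\<^sup>2 * \<delta> ?t / 2)) * E (\<lambda>x. cos (A x))\<bar>
      \<le> u\<^sup>2 / 2 * E (\<lambda>x. \<bar>dot p (F ?t x) (F ?t x) / p - \<delta> ?t\<bar>)
      + \<bar>u\<bar> ^ 3 / 12 * (\<eta> * E (\<lambda>x. (dot p (F ?t x) (x ?t))\<^sup>2) + E (\<lambda>x. dot p (F ?t x) (x ?t) ^ 4) / \<eta>)
      + u ^ 4 * (\<delta> ?t)\<^sup>2 / 8"
      using \<delta>[OF t] t by (intro E_cos_step aA fA F free \<eta>) auto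
    also have "\<dots> \<le> e"
      unfolding e_def using \<eta> \<delta>[OF t] e1[OF t] e2[OF t] e4[OF t]
      by (intro add_mono mult_left_mono divide_right_mono power_mono) auto
    finally have 1: "\<bar>E (\<lambda>x. cos (A x + u * dot p (F ?t x) (x ?t))) - exp (- (u\<^sup>2 * \<delta> ?t / 2)) * E (\<lambda>x. cos (A x))\<bar> \<le> e" .
    let ?q = "exp (- (u\<^sup>2 * \<delta> ?t / 2))"
    let ?r = "exp (- (u\<^sup>2 * (\<Sum>t\<in>{1..m}. \<delta> t) / 2)) * cos \<theta>"
    have IH: "\<bar>E (\<lambda>x. cos (A x)) - ?r\<bar> \<le> m * e" using Suc unfolding A_def by simp
    \<comment> \<open>Multiplication by \<open>?q\<close> does not amplify the error accumulated so
      far, so the errors simply add up.\<close>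
    have "?q \<le> 1" using \<delta>[OF t] by simp
    then have "?q * \<bar>E (\<lambda>x. cos (A x)) - ?r\<bar> \<le> m * e"
      using IH by (intro order_trans[OF mult_left_le_one_le]) auto
    then have "\<bar>?q * E (\<lambda>x. cos (A x)) - ?q * ?r\<bar> \<le> m * e"
      by (simp add: abs_mult right_diff_distrib[symmetric])
    then have "\<bar>E (\<lambda>x. cos (A x + u * dot p (F ?t x) (x ?t))) - ?q * ?r\<bar> \<le> e + m * e"
      using 1 by linarith
    moreover have "?q * ?r = exp (- (u\<^sup>2 * (\<Sum>t\<in>{1..?t}. \<delta> t) / 2)) * cos \<theta>"
      by (simp add: mult.assoc[symmetric] mult_exp_exp algebra_simps add_divide_distrib)
    moreover have "A x + u * dot p (F ?t x) (x ?t) = \<theta> + u * (\<Sum>t\<in>{1..?t}. dot p (F t x) (x t))" for x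
      by (simp add: A_def algebra_simps)
    moreover have "real ?t * e = e + m * e" by (simp add: algebra_simps)
    ultimately show ?case by (simp only:)
  qed
  then show ?thesis unfolding e_def by blast
qed

text \<open>The cosine is 1-Lipschitz; this disposes of a remainder that is small in mean.\<close>

lemma E_cos_perturb:
  assumes "adm f" "adm g"
  shows "\<bar>E (\<lambda>x. cos (\<theta> + u * (f x + g x))) - E (\<lambda>x. cos (\<theta> + u * f x))\<bar> \<le> \<bar>u\<bar> * E (\<lambda>x. \<bar>g x\<bar>)"
proof -
  have lip: "\<bar>cos a - cos b\<bar> \<le> \<bar>a - b\<bar>" for a b :: real
  proof -
    have "\<bar>cos a - cos b\<bar> = 2 * \<bar>sin ((a + b) / 2)\<bar> * \<bar>sin ((b - a) / 2)\<bar>"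
      by (simp add: cos_diff_cos abs_mult)
    also have "\<dots> \<le> 2 * 1 * \<bar>(b - a) / 2\<bar>"
      by (intro mult_mono abs_sin_le_one abs_sin_x_le_abs_x) auto
    finally show ?thesis by simp
  qed
  note ai = adm_intros assms
  have "\<bar>E (\<lambda>x. cos (\<theta> + u * (f x + g x))) - E (\<lambda>x. cos (\<theta> + u * f x))\<bar>
      = \<bar>E (\<lambda>x. cos (\<theta> + u * (f x + g x)) - cos (\<theta> + u * f x))\<bar>"
    by (subst E_diff) (intro ai refl)+
  also have "\<dots> \<le> E (\<lambda>x. \<bar>cos (\<theta> + u * (f x + g x)) - cos (\<theta> + u * f x)\<bar>)"
    by (intro abs_E_le ai)
  also have "\<dots> \<le> E (\<lambda>x. \<bar>u\<bar> * \<bar>g x\<bar>)"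
  proof (intro E_mono ai)
    show "\<bar>cos (\<theta> + u * (f x + g x)) - cos (\<theta> + u * f x)\<bar> \<le> \<bar>u\<bar> * \<bar>g x\<bar>" for x
      using lip[of "\<theta> + u * (f x + g x)" "\<theta> + u * f x"] by (simp add: algebra_simps abs_mult)
  qed
  finally show ?thesis by simp
qed

end

section \<open>Concentration of the conditional variances\<close>

text \<open>The power mean inequality, by Cauchy-Schwarz used twice.\<close>

lemma power4_sum_le:
  fixes f :: "'i \<Rightarrow> real"
  assumes "finite I"
  shows "(\<Sum>i\<in>I. f i) ^ 4 \<le> real (card I) ^ 3 * (\<Sum>i\<in>I. f i ^ 4)"
proof -
  have "(\<Sum>i\<in>I. f i) ^ 4 = ((\<Sum>i\<in>I. f i)\<^sup>2)\<^sup>2" by simp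
  also have "\<dots> \<le> ((\<Sum>i\<in>I. (f i)\<^sup>2) * card I)\<^sup>2"
    by (intro power_mono sum_squared_le_sum_of_squares) auto
  also have "\<dots> = (\<Sum>i\<in>I. (f i)\<^sup>2)\<^sup>2 * (real (card I))\<^sup>2" by (simp add: power_mult_distrib)
  also have "\<dots> \<le> ((\<Sum>i\<in>I. ((f i)\<^sup>2)\<^sup>2) * card I) * (real (card I))\<^sup>2"
    by (intro mult_right_mono sum_squared_le_sum_of_squares) auto
  finally show ?thesis by (simp add: power3_eq_cube power2_eq_square[of "real (card I)"] mult_ac)
qed

locale lagged_sample = sphere_sample +
  fixes H :: nat
  assumes H1: "H \<ge> 1" and nH: "n > 2 * H"
begin

definition a :: "nat \<Rightarrow> real" where "a h = 1 / real (n - h)"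

definition \<alpha> :: real where "\<alpha> = 1 / real (n - H)"

text \<open>\<open>\<beta>\<^sup>2\<close> bounds the fourth moment of \<open>B t s\<close>
  (\<open>E_B4\<close>): the power mean inequality gives \<open>H ^ 3\<close>, the sum has
  \<open>H\<close> terms, and each is at most \<open>\<alpha> ^ 4 * 3 / p\<^sup>2\<close>. Thus
  \<open>\<beta>\<close> bounds the size of the square of \<open>B t s\<close>, and
  \<open>\<beta> * n\<close> up to a constant that of \<open>Y\<close>.\<close>

definition \<beta> :: real where "\<beta> = sqrt 3 * (real H)\<^sup>2 * \<alpha>\<^sup>2 / p"

text \<open>The exact mean of \<open>(B t s x)\<^sup>2\<close> for \<open>H < s < t - H\<close>
  (\<open>E_B2\<close>), the same for all such \<open>s\<close> and \<open>t\<close>.\<close>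

definition b :: real where "b = (\<Sum>h\<in>{1..H}. (a h)\<^sup>2) / p"

text \<open>Once the sum over the lags is moved inside, this is the coefficient of
  \<open>dot p (x s) (x t)\<close> in the statistic for \<open>s > H\<close>, up to the constant
  factor \<open>c\<close>.\<close>

definition B :: "nat \<Rightarrow> nat \<Rightarrow> (nat \<Rightarrow> nat \<Rightarrow> real) \<Rightarrow> real" where
  "B t s x = (\<Sum>h\<in>{1..H}. a h * dot p (x (s - h)) (x (t - h)))"

text \<open>The vector of the header is \<open>W t (t - H)\<close>, up to the terms collected in \<open>R\<close> below. For
  \<open>s < t - H\<close> the coefficient \<open>B t s\<close> involves only times before \<open>s\<close> and times from \<open>t - H\<close> on, so
  that it does not depend on the vector at time \<open>s\<close>.\<close>
definition W :: "nat \<Rightarrow> nat \<Rightarrow> (nat \<Rightarrow> nat \<Rightarrow> real) \<Rightarrow> nat \<Rightarrow> real" where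
  "W t s x = (\<lambda>i. \<Sum>r\<in>{H<..<s}. B t r x * x r i)"

abbreviation Y :: "nat \<Rightarrow> nat \<Rightarrow> (nat \<Rightarrow> nat \<Rightarrow> real) \<Rightarrow> real" where
  "Y t s x \<equiv> dot p (W t s x) (W t s x)"

section \<open>Dependence structure and fourth moments of the coefficients\<close>

lemma p_pos: "real p > 0" using p_ge by simp

lemma \<alpha>_pos: "\<alpha> > 0" using nH by (simp add: \<alpha>_def)

lemma \<beta>_pos: "\<beta> > 0" using \<alpha>_pos H1 p_pos by (simp add: \<beta>_def)

lemma \<beta>_sq: "\<beta>\<^sup>2 = 3 * real H ^ 4 * \<alpha> ^ 4 / (real p)\<^sup>2"
  by (simp add: \<beta>_def power_mult_distrib power_divide)

lemma a_bounds: "h \<in> {1..H} \<Longrightarrow> 0 < a h \<and> a h \<le> \<alpha>"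
  using nH by (auto simp: a_def \<alpha>_def intro!: divide_left_mono)

lemma adm_B: "H < s \<Longrightarrow> s \<le> n \<Longrightarrow> H < t \<Longrightarrow> t \<le> n \<Longrightarrow> adm (B t s)"
  unfolding B_def by (intro adm_intros) auto

lemma adm_W: "s \<le> t \<Longrightarrow> t \<le> n \<Longrightarrow> i < p \<Longrightarrow> adm (\<lambda>x. W t s x i)"
  unfolding W_def by (intro adm_intros adm_B) auto

lemma adm_Y: "s \<le> t \<Longrightarrow> t \<le> n \<Longrightarrow> adm (\<lambda>x. Y t s x)"
  by (intro adm_dot adm_W)

text \<open>\<open>B t s\<close> reads only the times from \<open>s - H\<close> to
  \<open>s - 1\<close> and from \<open>t - H\<close> to \<open>t - 1\<close>; \<open>k\<close> lies
  in the gap between these windows or beyond both.\<close>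

lemma free_B: "H < s \<Longrightarrow> s \<le> k \<Longrightarrow> k < t - H \<or> t \<le> k \<Longrightarrow> H < t \<Longrightarrow> free_of k (B t s)"
  unfolding free_of_def B_def by (intro allI sum.cong refl) auto

lemma free_W:
  assumes "s \<le> k" "s \<le> t" "k < t - H \<or> t \<le> k"
  shows "free_of k (W t s)"
proof -
  have "B t r (x(k := y)) * (x(k := y)) r i = B t r x * x r i" if "r \<in> {H<..<s}" for r x y i
    using that assms free_B[of r k t] by (auto simp: free_of_def)
  then show ?thesis unfolding free_of_def W_def by (intro allI ext sum.cong refl)
qed

lemma E_B4:
  assumes "H < s" "s < t" "t \<le> n"
  shows "E (\<lambda>x. B t s x ^ 4) \<le> \<beta>\<^sup>2"
proof -
  have ai: "adm (\<lambda>x. dot p (x (s - h)) (x (t - h)))" if "h \<in> {1..H}" for h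
    using that assms by (intro adm_intros) auto
  have "E (\<lambda>x. B t s x ^ 4) \<le> E (\<lambda>x. real H ^ 3 * (\<Sum>h\<in>{1..H}. (a h * dot p (x (s - h)) (x (t - h))) ^ 4))"
    using power4_sum_le[of "{1..H}"] assms ai unfolding B_def
    by (intro E_mono adm_intros) auto
  also have "\<dots> = real H ^ 3 * (\<Sum>h\<in>{1..H}. a h ^ 4 * E (\<lambda>x. dot p (x (s - h)) (x (t - h)) ^ 4))"
    unfolding power_mult_distrib Bochner_Integration.integral_mult_right_zero
    using assms by (subst E_sum) (auto intro!: adm_intros)
  also have "\<dots> \<le> real H ^ 3 * (\<Sum>h\<in>{1..H}. \<alpha> ^ 4 * (3 / (real p)\<^sup>2))"
    using assms a_bounds
    by (intro mult_left_mono sum_mono mult_mono power_mono E_dot_pair E_nonneg) (auto intro: less_imp_le)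
  also have "\<dots> = \<beta>\<^sup>2" by (simp add: \<beta>_sq power3_eq_cube power4_eq_xxxx)
  finally show ?thesis .
qed

section \<open>Growth of the squared norm, one time index at a time\<close>

lemma W_Suc: "H < s \<Longrightarrow> W t (Suc s) x = (\<lambda>i. W t s x i + B t s x * x s i)"
proof -
  assume "H < s"
  then have "{H<..<Suc s} = insert s {H<..<s}" by auto
  then show ?thesis by (simp add: W_def add.commute)
qed

lemma Y_Suc:
  assumes "H < s"
  shows "Y t (Suc s) x = Y t s x + 2 * B t s x * dot p (W t s x) (x s) + (B t s x)\<^sup>2 * dot p (x s) (x s)"
  unfolding W_Suc[OF assms] dot_add dot_scale
  by (simp add: dot_commute[of p "x s" "W t s x"] power2_eq_square algebra_simps)

lemma E_B2Y:
  assumes "H < s" "s < t" "t \<le> n" "E (\<lambda>x. (Y t s x)\<^sup>2) \<le> z\<^sup>2" "z > 0"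
  shows "E (\<lambda>x. (B t s x)\<^sup>2 * Y t s x) \<le> \<beta> * z"
  using assms E_B4[of s t] by (intro E_mult_le \<beta>_pos adm_intros adm_B adm_W) auto

text \<open>With \<open>z\<close> the bound at \<open>s\<close>, the bound at \<open>s + 1\<close> is \<open>z\<^sup>2 + 6 \<beta> z + \<beta>\<^sup>2 \<le> (z + 3 \<beta>)\<^sup>2\<close>.\<close>
lemma E_Y2:
  assumes "H < s" "s \<le> t - H" "t \<le> n"
  shows "E (\<lambda>x. (Y t s x)\<^sup>2) \<le> (3 * \<beta> * s)\<^sup>2"
proof -
  from assms(1) have "Suc H \<le> s" by simp
  then show ?thesis using assms(2)
  proof (induction s rule: dec_induct)
    case base
    have "{H<..<Suc H} = {}" by auto
    then show ?case by (simp add: W_def dot_def)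
  next
    case (step s)
    have s: "H < s" "s < t - H" "s < t" "s \<in> {1..n}" "H < t" using step assms by auto
    have aB: "adm (B t s)" and aW: "\<And>i. i < p \<Longrightarrow> adm (\<lambda>x. W t s x i)" and aY: "adm (\<lambda>x. Y t s x)"
      using s assms by (auto intro!: adm_B adm_W adm_Y)
    have fB: "free_of s (B t s)" and fW: "free_of s (W t s)" using s by (auto intro!: free_B free_W)
    have aL: "adm (\<lambda>x. dot p (W t s x) (x s))" using aW s by (intro adm_intros) auto
    \<comment> \<open>\<open>4 * G x\<close> is the coefficient of
      \<open>dot p (W t s x) (x s)\<close> in the square of \<open>Y t (Suc s) x\<close>; being free
      of \<open>s\<close>, it makes that term vanish in mean.\<close>
    define G where "G x = (Y t s x + (B t s x)\<^sup>2) * B t s x" for x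
    have G: "adm G" "free_of s G"
      unfolding G_def using aB aY fB fW by (auto intro!: adm_intros simp: free_of_def)
    let ?x = "3 * \<beta> * s"
    have xp: "?x > 0" using \<beta>_pos s by auto
    have IH: "E (\<lambda>x. (Y t s x)\<^sup>2) \<le> ?x\<^sup>2" using step by simp
    have BY: "E (\<lambda>x. (B t s x)\<^sup>2 * Y t s x) \<le> \<beta> * ?x"
      using s assms IH xp by (intro E_B2Y) auto
    note ai = adm_intros aB aY G(1) aL
    have "E (\<lambda>x. (Y t (Suc s) x)\<^sup>2)
       = E (\<lambda>x. (((Y t s x)\<^sup>2 + 2 * ((B t s x)\<^sup>2 * Y t s x)) + B t s x ^ 4)
           + 4 * (G x * dot p (W t s x) (x s)) + 4 * ((B t s x)\<^sup>2 * (dot p (W t s x) (x s))\<^sup>2))"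
    proof (rule E_cong_unit)
      show "adm (\<lambda>x. (Y t (Suc s) x)\<^sup>2)" using s assms by (intro adm_intros adm_W) auto
      show "adm (\<lambda>x. (((Y t s x)\<^sup>2 + 2 * ((B t s x)\<^sup>2 * Y t s x)) + B t s x ^ 4)
           + 4 * (G x * dot p (W t s x) (x s)) + 4 * ((B t s x)\<^sup>2 * (dot p (W t s x) (x s))\<^sup>2))"
        by (intro ai)
      fix x assume "\<And>k. k \<in> {1..n} \<Longrightarrow> dot p (x k) (x k) = 1"
      then have "dot p (x s) (x s) = 1" using s by simp
      then show "(Y t (Suc s) x)\<^sup>2 = (((Y t s x)\<^sup>2 + 2 * ((B t s x)\<^sup>2 * Y t s x)) + B t s x ^ 4)
           + 4 * (G x * dot p (W t s x) (x s)) + 4 * ((B t s x)\<^sup>2 * (dot p (W t s x) (x s))\<^sup>2)"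
        unfolding Y_Suc[OF s(1)] G_def by (simp add: power2_eq_square power4_eq_xxxx algebra_simps)
    qed
    also have "\<dots> = E (\<lambda>x. (Y t s x)\<^sup>2) + 2 * E (\<lambda>x. (B t s x)\<^sup>2 * Y t s x) + E (\<lambda>x. B t s x ^ 4)
        + 4 * E (\<lambda>x. G x * dot p (W t s x) (x s)) + 4 * E (\<lambda>x. (B t s x)\<^sup>2 * (dot p (W t s x) (x s))\<^sup>2)"
      by (simp only: E_add ai Bochner_Integration.integral_mult_right_zero)
    also have "E (\<lambda>x. G x * dot p (W t s x) (x s)) = 0"
      by (rule E_linear[OF s(4) G aW fW])
    also have "E (\<lambda>x. (B t s x)\<^sup>2 * (dot p (W t s x) (x s))\<^sup>2) = E (\<lambda>x. (B t s x)\<^sup>2 * Y t s x) / p"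
      using fB by (intro E_square s adm_intros aB aW fW) (auto simp: free_of_def)
    \<comment> \<open>Bounding \<open>1 / p\<close> by 1 in the last term gives another
      \<open>4 * \<beta> * ?x\<close>, hence the coefficient 6 in total.\<close>
    also have "E (\<lambda>x. (Y t s x)\<^sup>2) + 2 * E (\<lambda>x. (B t s x)\<^sup>2 * Y t s x) + E (\<lambda>x. B t s x ^ 4) + 4 * 0
        + 4 * (E (\<lambda>x. (B t s x)\<^sup>2 * Y t s x) / p) \<le> ?x\<^sup>2 + 2 * (\<beta> * ?x) + \<beta>\<^sup>2 + 4 * 0 + 4 * (\<beta> * ?x / 1)"
      using E_B4[of s t] s assms IH BY p_ge \<beta>_pos xp
      by (intro add_mono mult_left_mono frac_le) auto
    also have "\<dots> = (?x + 3 * \<beta>)\<^sup>2 - 8 * \<beta>\<^sup>2" by (simp add: power2_eq_square algebra_simps)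
    also have "\<dots> \<le> (?x + 3 * \<beta>)\<^sup>2" by simp
    also have "?x + 3 * \<beta> = 3 * \<beta> * Suc s" by (simp add: algebra_simps)
    finally show ?case .
  qed
qed

text \<open>These are the cross terms in the growth of \<open>Y\<close>, a martingale in
  \<open>s\<close>. Orthogonality leaves four times the mean of
  \<open>(B t s x)\<^sup>2 * Y t s x\<close>, divided by \<open>p\<close>, for each index; with
  \<open>Y\<close> of size \<open>3 * \<beta> * n\<close> the total is of order \<open>1 / p\<close>
  relative to \<open>(\<beta> * n)\<^sup>2\<close>.\<close>

lemma E_offdiag:
  assumes "t \<le> n"
  shows "E (\<lambda>x. (\<Sum>s\<in>{H<..<t - H}. dot p (\<lambda>i. 2 * B t s x * W t s x i) (x s))\<^sup>2) \<le> 12 * \<beta>\<^sup>2 * (real n)\<^sup>2 / p"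
proof -
  let ?F = "\<lambda>s x i. 2 * B t s x * W t s x i"
  have "E (\<lambda>x. (\<Sum>s\<in>{H<..<t - H}. dot p (?F s x) (x s))\<^sup>2) = (\<Sum>s\<in>{H<..<t - H}. E (\<lambda>x. dot p (?F s x) (?F s x))) / p"
  proof (rule E_square_sum)
    fix k l assume kl: "k \<in> {H<..<t - H}" "l \<in> {H<..<t - H}" "l \<le> k"
    have "free_of k (B t l)" "free_of k (W t l)" using kl by (auto intro!: free_B free_W)
    then show "free_of k (?F l)" by (auto simp: free_of_def)
  qed (use assms in \<open>auto intro!: adm_intros adm_B adm_W\<close>)
  also have "\<dots> = (\<Sum>s\<in>{H<..<t - H}. 4 * E (\<lambda>x. (B t s x)\<^sup>2 * Y t s x)) / p"
    by (simp add: dot_scale power2_eq_square mult_ac)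
  also have "\<dots> \<le> (\<Sum>s\<in>{H<..<t - H}. 4 * (\<beta> * (3 * \<beta> * n))) / p"
  proof (intro divide_right_mono sum_mono mult_left_mono)
    fix s assume s: "s \<in> {H<..<t - H}"
    have "E (\<lambda>x. (B t s x)\<^sup>2 * Y t s x) \<le> \<beta> * (3 * \<beta> * s)"
      using s assms \<beta>_pos by (intro E_B2Y E_Y2) auto
    also have "\<dots> \<le> \<beta> * (3 * \<beta> * n)" using s assms \<beta>_pos by (intro mult_left_mono) auto
    finally show "E (\<lambda>x. (B t s x)\<^sup>2 * Y t s x) \<le> \<beta> * (3 * \<beta> * n)" .
  qed auto
  also have "\<dots> = real (card {H<..<t - H}) * (12 * \<beta>\<^sup>2 * n) / p"
    by (simp add: power2_eq_square)
  also have "\<dots> \<le> real n * (12 * \<beta>\<^sup>2 * n) / p"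
    using assms by (intro divide_right_mono mult_right_mono) auto
  finally show ?thesis by (simp add: power2_eq_square mult_ac)
qed

text \<open>Expand the square over pairs of lags and integrate out \<open>x (s - h)\<close>. For two
  different lags it occurs linearly in a single factor, since \<open>s < t - H\<close> keeps the
  late window away from it, and the term vanishes. For equal lags what remains is
  \<open>1 / p\<close>, as \<open>x (t - h)\<close> is a unit vector.\<close>

lemma E_weighted_B2:
  assumes s: "H < s" "s < t - H" "t \<le> n" and G: "adm G" "\<And>h. h \<in> {1..H} \<Longrightarrow> free_of (s - h) G"
  shows "E (\<lambda>x. G x * (B t s x)\<^sup>2) = b * E G"
proof -
  let ?Q = "\<lambda>h x. dot p (x (s - h)) (x (t - h))"
  have aQ: "adm (?Q h)" if "h \<in> {1..H}" for h
    using that s by (intro adm_intros) auto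
  have cross: "E (\<lambda>x. G x * (?Q h x * ?Q h' x)) = (if h = h' then E G / p else 0)"
    if h: "h \<in> {1..H}" "h' \<in> {1..H}" for h h'
  proof -
    have k: "s - h \<in> {1..n}" using h s by auto
    have F: "\<And>i. i < p \<Longrightarrow> adm (\<lambda>x. x (t - h) i)" "free_of (s - h) (\<lambda>x. x (t - h))"
      using h s by (auto intro!: adm_intros simp: free_of_def)
    show ?thesis
    proof (cases "h = h'")
      case True
      have "E (\<lambda>x. G x * (dot p (x (t - h)) (x (s - h)))\<^sup>2) = E (\<lambda>x. G x * dot p (x (t - h)) (x (t - h))) / p"
        using h by (intro E_square k G F)
      also have "E (\<lambda>x. G x * dot p (x (t - h)) (x (t - h))) = E G"
      proof (rule E_cong_unit)
        fix x :: "nat \<Rightarrow> nat \<Rightarrow> real"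
        assume "\<And>k. k \<in> {1..n} \<Longrightarrow> dot p (x k) (x k) = 1"
        moreover have "t - h \<in> {1..n}" using h s by auto
        ultimately show "G x * dot p (x (t - h)) (x (t - h)) = G x" by (simp del: atLeastAtMost_iff)
      qed (use h s G in \<open>auto intro!: adm_intros\<close>)
      finally show ?thesis using True by (simp add: dot_commute power2_eq_square)
    next
      case False
      have "E (\<lambda>x. (G x * ?Q h' x) * dot p (x (t - h)) (x (s - h))) = 0"
      proof (rule E_linear[OF k _ _ F])
        show "adm (\<lambda>x. G x * ?Q h' x)" by (intro adm_mult G aQ h)
        show "free_of (s - h) (\<lambda>x. G x * ?Q h' x)"
          using G(2)[OF h(1)] h s False by (auto simp: free_of_def)
      qed
      then show ?thesis using False by (simp add: dot_commute mult_ac)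
    qed
  qed
  have "E (\<lambda>x. G x * (B t s x)\<^sup>2)
      = E (\<lambda>x. \<Sum>h\<in>{1..H}. \<Sum>h'\<in>{1..H}. a h * a h' * (G x * (?Q h x * ?Q h' x)))"
    by (simp add: B_def power2_eq_square sum_product sum_distrib_left mult_ac)
  also have "\<dots> = (\<Sum>h\<in>{1..H}. \<Sum>h'\<in>{1..H}. a h * a h' * E (\<lambda>x. G x * (?Q h x * ?Q h' x)))"
    using aQ G by (subst E_sum, (intro adm_sum adm_mult adm_const aQ G; simp), intro sum.cong refl, subst E_sum, (intro adm_sum adm_mult adm_const aQ G; simp)) simp
  also have "\<dots> = (\<Sum>h\<in>{1..H}. \<Sum>h'\<in>{1..H}. if h = h' then (a h)\<^sup>2 * (E G / p) else 0)"
    by (intro sum.cong refl) (auto simp: cross power2_eq_square)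
  also have "\<dots> = b * E G"
    by (simp add: sum.delta b_def sum_divide_distrib sum_distrib_right)
  finally show ?thesis .
qed

lemma E_B2: "H < s \<Longrightarrow> s < t - H \<Longrightarrow> t \<le> n \<Longrightarrow> E (\<lambda>x. (B t s x)\<^sup>2) = b"
  using E_weighted_B2[of s t "\<lambda>_. 1"] by (simp add: adm_intros free_of_def)

lemma E_centered_B2_sq:
  assumes "H < s" "s < t - H" "t \<le> n"
  shows "E (\<lambda>x. ((B t s x)\<^sup>2 - b)\<^sup>2) \<le> \<beta>\<^sup>2"
proof -
  have aB: "adm (B t s)" using assms by (intro adm_B) auto
  have "E (\<lambda>x. ((B t s x)\<^sup>2 - b)\<^sup>2) = E (\<lambda>x. (B t s x ^ 4 - 2 * b * (B t s x)\<^sup>2) + b\<^sup>2)"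
    by (simp add: power2_diff algebra_simps)
  also have "\<dots> = E (\<lambda>x. B t s x ^ 4) - 2 * b * E (\<lambda>x. (B t s x)\<^sup>2) + b\<^sup>2"
    by (simp only: E_diff E_add E_const adm_intros aB Bochner_Integration.integral_mult_right_zero)
  also have "\<dots> \<le> \<beta>\<^sup>2 - b\<^sup>2"
    using E_B4[of s t] E_B2[of s t] assms by (simp add: power2_eq_square)
  finally show ?thesis by (smt (verit) zero_le_power2)
qed

text \<open>If \<open>s + H \<le> r\<close>, the times from \<open>r - H\<close> to
  \<open>r - 1\<close> are all at least \<open>s\<close>, hence outside the windows of
  \<open>B t s\<close>, and \<open>E_weighted_B2\<close> makes the covariance zero although both
  coefficients share the times just before \<open>t\<close>. Closer pairs are bounded by
  Cauchy-Schwarz.\<close>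

lemma E_cov_B2:
  assumes s: "H < s" "s < t - H" "H < r" "r < t - H" "t \<le> n"
  shows "E (\<lambda>x. ((B t s x)\<^sup>2 - b) * ((B t r x)\<^sup>2 - b)) \<le> (if s < r + H \<and> r < s + H then \<beta>\<^sup>2 else 0)"
proof -
  have zero: "E (\<lambda>x. ((B t s x)\<^sup>2 - b) * ((B t r x)\<^sup>2 - b)) = 0"
    if "H < s" "H < r" "r < t - H" "s + H \<le> r" for s r
  proof -
    let ?G = "\<lambda>x. (B t s x)\<^sup>2 - b"
    have aB: "adm (B t s)" "adm (B t r)" using that s by (auto intro!: adm_B)
    have "E (\<lambda>x. ?G x * (B t r x)\<^sup>2) = b * E ?G"
    proof (rule E_weighted_B2)
      fix h assume h: "h \<in> {1..H}"
      have "free_of (r - h) (B t s)" using that h s by (intro free_B) auto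
      then show "free_of (r - h) ?G" by (simp add: free_of_def)
    qed (use that s aB in \<open>auto intro!: adm_intros\<close>)
    moreover have "E (\<lambda>x. ?G x * ((B t r x)\<^sup>2 - b)) = E (\<lambda>x. ?G x * (B t r x)\<^sup>2) - b * E ?G"
      unfolding right_diff_distrib using aB
      by (subst E_diff) (auto intro!: adm_intros simp: mult.commute[of _ b])
    ultimately show ?thesis by simp
  qed
  show ?thesis
  proof (cases "s < r + H \<and> r < s + H")
    case True
    have "E (\<lambda>x. ((B t s x)\<^sup>2 - b) * ((B t r x)\<^sup>2 - b)) \<le> \<beta> * \<beta>"
      using s by (intro E_mult_le \<beta>_pos E_centered_B2_sq adm_intros adm_B) auto
    then show ?thesis using True by (simp add: power2_eq_square)
  next
    case False
    then have "r + H \<le> s \<or> s + H \<le> r" by auto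
    then show ?thesis
      using zero[of s r] zero[of r s] s False by (auto simp: mult.commute)
  qed
qed

text \<open>Only pairs at distance less than \<open>H\<close> contribute, at most
  \<open>2 * H\<close> of them for each \<open>s\<close>. Relative to
  \<open>(\<beta> * n)\<^sup>2\<close> this is of order \<open>1 / n\<close>.\<close>

lemma E_diag:
  assumes "t \<le> n"
  shows "E (\<lambda>x. (\<Sum>s\<in>{H<..<t - H}. (B t s x)\<^sup>2 - b)\<^sup>2) \<le> 2 * real H * \<beta>\<^sup>2 * n"
proof -
  let ?K = "{H<..<t - H}"
  have aB: "s \<in> ?K \<Longrightarrow> adm (B t s)" for s using assms by (intro adm_B) auto
  have "E (\<lambda>x. (\<Sum>s\<in>?K. (B t s x)\<^sup>2 - b)\<^sup>2)
      = E (\<lambda>x. \<Sum>s\<in>?K. \<Sum>r\<in>?K. ((B t s x)\<^sup>2 - b) * ((B t r x)\<^sup>2 - b))"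
    by (simp add: power2_eq_square sum_product)
  also have "\<dots> = (\<Sum>s\<in>?K. \<Sum>r\<in>?K. E (\<lambda>x. ((B t s x)\<^sup>2 - b) * ((B t r x)\<^sup>2 - b)))"
    using aB by (subst E_sum, (intro adm_intros; simp), intro sum.cong refl, subst E_sum, (intro adm_intros; simp)) simp
  also have "\<dots> \<le> (\<Sum>s\<in>?K. \<Sum>r\<in>?K. if s < r + H \<and> r < s + H then \<beta>\<^sup>2 else 0)"
    using assms by (intro sum_mono E_cov_B2) auto
  also have "\<dots> \<le> (\<Sum>s\<in>?K. 2 * real H * \<beta>\<^sup>2)"
  proof (rule sum_mono)
    fix s
    have "(\<Sum>r\<in>?K. if s < r + H \<and> r < s + H then \<beta>\<^sup>2 else 0)
        = real (card (?K \<inter> {r. s < r + H \<and> r < s + H})) * \<beta>\<^sup>2"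
      by (simp add: sum.If_cases)
    also have "card (?K \<inter> {r. s < r + H \<and> r < s + H}) \<le> card {s - H..<s + H}"
      by (intro card_mono) auto
    then have "real (card (?K \<inter> {r. s < r + H \<and> r < s + H})) * \<beta>\<^sup>2 \<le> 2 * real H * \<beta>\<^sup>2"
      by (intro mult_right_mono) auto
    finally show "(\<Sum>r\<in>?K. if s < r + H \<and> r < s + H then \<beta>\<^sup>2 else 0) \<le> 2 * real H * \<beta>\<^sup>2" .
  qed
  also have "\<dots> = real (card ?K) * (2 * real H * \<beta>\<^sup>2)" by simp
  also have "\<dots> \<le> real n * (2 * real H * \<beta>\<^sup>2)"
    using assms by (intro mult_right_mono) auto
  finally show ?thesis by (simp add: mult_ac)
qed

text \<open>Iterates \<open>Y_Suc\<close>. For \<open>s = t - H\<close> the first sum is the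
  martingale of \<open>E_offdiag\<close>, and the second, once centered by \<open>b\<close>, is the
  sum of \<open>E_diag\<close>.\<close>

lemma Y_decomp:
  assumes unit: "\<And>k. k \<in> {1..n} \<Longrightarrow> dot p (x k) (x k) = 1" and "s \<le> n"
  shows "Y t s x = (\<Sum>r\<in>{H<..<s}. dot p (\<lambda>i. 2 * B t r x * W t r x i) (x r)) + (\<Sum>r\<in>{H<..<s}. (B t r x)\<^sup>2)"
  using assms(2)
proof (induction s)
  case 0
  then show ?case by (simp add: W_def dot_def)
next
  case (Suc s)
  show ?case
  proof (cases "H < s")
    case True
    then have "{H<..<Suc s} = insert s {H<..<s}" by auto
    then show ?thesis
      using Suc True unit[of s] by (simp add: Y_Suc[OF True] dot_scale)
  next
    case False
    then have "{H<..<Suc s} = {}" by auto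
    then show ?thesis by (simp add: W_def dot_def)
  qed
qed

text \<open>Relative to \<open>(\<beta> * n)\<^sup>2\<close> the bound is
  \<open>24 / p + 4 * H / n\<close>, which vanishes when both \<open>p\<close> and \<open>n\<close>
  grow. It is written as a square to suit \<open>E_abs_le\<close>.\<close>

lemma E_Y_concentration:
  assumes "t \<le> n"
  shows "E (\<lambda>x. (Y t (t - H) x - b * card {H<..<t - H})\<^sup>2)
    \<le> (\<beta> * sqrt (24 * (real n)\<^sup>2 / p + 4 * real H * n))\<^sup>2"
proof -
  let ?K = "{H<..<t - H}"
  let ?N = "\<lambda>x. \<Sum>s\<in>?K. dot p (\<lambda>i. 2 * B t s x * W t s x i) (x s)"
  let ?V = "\<lambda>x. \<Sum>s\<in>?K. (B t s x)\<^sup>2 - b"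
  have a1: "adm ?N" "adm ?V" "adm (\<lambda>x. Y t (t - H) x)"
    using assms by (auto intro!: adm_intros adm_B adm_W)
  have "E (\<lambda>x. (Y t (t - H) x - b * card ?K)\<^sup>2) \<le> E (\<lambda>x. 2 * (?N x)\<^sup>2 + 2 * (?V x)\<^sup>2)"
  proof (rule E_mono_unit)
    show "adm (\<lambda>x. (Y t (t - H) x - b * card ?K)\<^sup>2)" "adm (\<lambda>x. 2 * (?N x)\<^sup>2 + 2 * (?V x)\<^sup>2)"
      using a1 by (auto intro!: adm_add adm_mult adm_power adm_diff adm_const)
    fix x assume "\<And>k. k \<in> {1..n} \<Longrightarrow> dot p (x k) (x k) = 1"
    then have "Y t (t - H) x - b * card ?K = ?N x + ?V x"
      using Y_decomp[of x "t - H" t] assms by (simp add: sum_subtractf)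
    moreover have "(u + v)\<^sup>2 \<le> 2 * u\<^sup>2 + 2 * v\<^sup>2" for u v :: real
      using sum_squares_bound[of u v] by (simp add: power2_sum)
    ultimately show "(Y t (t - H) x - b * card ?K)\<^sup>2 \<le> 2 * (?N x)\<^sup>2 + 2 * (?V x)\<^sup>2" by simp
  qed
  also have "\<dots> = 2 * E (\<lambda>x. (?N x)\<^sup>2) + 2 * E (\<lambda>x. (?V x)\<^sup>2)"
    using a1 by (subst E_add) (auto intro!: adm_mult adm_power adm_const)
  also have "\<dots> \<le> 2 * (12 * \<beta>\<^sup>2 * (real n)\<^sup>2 / p) + 2 * (2 * real H * \<beta>\<^sup>2 * n)"
    using E_offdiag[OF assms] E_diag[OF assms] by (intro add_mono mult_left_mono) auto
  also have "\<dots> = (\<beta> * sqrt (24 * (real n)\<^sup>2 / p + 4 * real H * n))\<^sup>2"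
    using p_pos by (simp add: power_mult_distrib algebra_simps)
  finally show ?thesis .
qed

end

section \<open>Normal approximation of the statistic\<close>

lemma sum_pairs:
  fixes f :: "nat \<Rightarrow> nat \<Rightarrow> real"
  shows "(\<Sum>(s, t)\<in>{(s, t). h + 1 \<le> s \<and> s < t \<and> t \<le> n}. f s t) = (\<Sum>t\<in>{1..n}. \<Sum>s\<in>{h<..<t}. f s t)"
proof -
  have "(\<Sum>t\<in>{1..n}. \<Sum>s\<in>{h<..<t}. f s t) = (\<Sum>(t, s)\<in>Sigma {1..n} (\<lambda>t. {h<..<t}). f s t)"
    by (subst sum.Sigma) auto
  also have "\<dots> = (\<Sum>(s, t)\<in>{(s, t). h + 1 \<le> s \<and> s < t \<and> t \<le> n}. f s t)"
    by (rule sum.reindex_bij_witness[where i="\<lambda>(s, t). (t, s)" and j="\<lambda>(t, s). (s, t)"]) auto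
  finally show ?thesis ..
qed

context lagged_sample
begin

definition c :: real where "c = sqrt 2 * p / sqrt H"

definition F :: "nat \<Rightarrow> (nat \<Rightarrow> nat \<Rightarrow> real) \<Rightarrow> nat \<Rightarrow> real" where
  "F t x = (\<lambda>i. c * W t (t - H) x i)"

text \<open>The pairs of lag and time that the main part leaves out: \<open>s\<close> at most
  \<open>H\<close>, or at least \<open>t - H\<close>. Their number is bounded in terms of
  \<open>H\<close> alone (\<open>card_Z\<close>), which makes \<open>R\<close> negligible.\<close>

definition Z :: "nat \<Rightarrow> (nat \<times> nat) set" where
  "Z t = Sigma {1..H} (\<lambda>h. {h<..<t} - {H<..<t - H})"

definition R :: "nat \<Rightarrow> (nat \<Rightarrow> nat \<Rightarrow> real) \<Rightarrow> nat \<Rightarrow> real" where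
  "R t x = (\<lambda>i. \<Sum>(h, s)\<in>Z t. a h * dot p (x (s - h)) (x (t - h)) * x s i)"

lemma c_sq: "c\<^sup>2 = 2 * (real p)\<^sup>2 / H"
  by (simp add: c_def power_mult_distrib power_divide)

lemma c_sq_div: "c\<^sup>2 / p = 2 * real p / H"
  unfolding c_sq by (simp add: power2_eq_square)

lemma dot_self: "dot p v v = (\<Sum>i<p. (v i)\<^sup>2)"
  by (simp add: dot_def power2_eq_square)

lemma finite_Z: "finite (Z t)" by (auto simp: Z_def)

lemma card_Z: "card (Z t) \<le> 2 * H * H"
proof -
  have "card ({h<..<t} - {H<..<t - H}) \<le> 2 * H" if "h \<in> {1..H}" for h
    using that by (subst card_Diff_subset) auto
  then have "(\<Sum>h\<in>{1..H}. card ({h<..<t} - {H<..<t - H})) \<le> (\<Sum>h\<in>{1..H}. 2 * H)"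
    by (intro sum_mono) auto
  then show ?thesis by (simp add: Z_def)
qed

lemma adm_R: "t \<le> n \<Longrightarrow> i < p \<Longrightarrow> adm (\<lambda>x. R t x i)"
  unfolding R_def case_prod_unfold by (intro adm_intros) (auto simp: Z_def)

lemma free_R:
  assumes "t \<le> k" shows "free_of k (R t)"
proof -
  have "a h * dot p ((x(k := y)) (s - h)) ((x(k := y)) (t - h)) * (x(k := y)) s i
      = a h * dot p (x (s - h)) (x (t - h)) * x s i" if "(h, s) \<in> Z t" for h s x y i
    using that assms by (auto simp: Z_def)
  then show ?thesis unfolding free_of_def R_def
    by (intro allI ext sum.cong refl) (auto simp del: fun_upd_apply)
qed

lemma adm_F: "t \<le> n \<Longrightarrow> i < p \<Longrightarrow> adm (\<lambda>x. F t x i)"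
  unfolding F_def by (intro adm_intros adm_W) auto

lemma free_F: "t \<le> k \<Longrightarrow> free_of k (F t)"
  using free_W[of "t - H" k t] by (simp add: free_of_def F_def)

lemma dot_F: "dot p (F t x) (F t x) = c\<^sup>2 * Y t (t - H) x"
  by (simp add: F_def dot_scale power2_eq_square)

text \<open>Summing over \<open>t\<close> outermost turns the statistic into a sum of martingale
  differences. For each lag the times \<open>s\<close> between \<open>h\<close> and \<open>t\<close>
  split into those kept in \<open>F\<close> and those collected in \<open>R\<close>.\<close>

lemma T_St_alt_decomp:
  "T_St_alt H p n x = (\<Sum>t\<in>{1..n}. dot p (F t x) (x t)) + (\<Sum>t\<in>{1..n}. dot p (\<lambda>i. c * R t x i) (x t))"
proof -
  let ?f = "\<lambda>h s t. a h * dot p (x (s - h)) (x (t - h)) * dot p (x s) (x t)"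
  have 1: "dot p (F t x) (x t) + dot p (\<lambda>i. c * R t x i) (x t) = c * (\<Sum>h\<in>{1..H}. \<Sum>s\<in>{h<..<t}. ?f h s t)" for t
  proof -
    have "dot p (F t x) (x t) = c * (\<Sum>s\<in>{H<..<t - H}. \<Sum>h\<in>{1..H}. ?f h s t)"
      by (simp add: F_def W_def dot_scale dot_sum B_def sum_distrib_right)
    also have "\<dots> = c * (\<Sum>h\<in>{1..H}. \<Sum>s\<in>{H<..<t - H}. ?f h s t)"
      by (subst sum.swap) simp
    finally have F: "dot p (F t x) (x t) = c * (\<Sum>h\<in>{1..H}. \<Sum>s\<in>{H<..<t - H}. ?f h s t)" .
    have "dot p (\<lambda>i. c * R t x i) (x t) = c * (\<Sum>(h, s)\<in>Z t. ?f h s t)"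
      by (simp add: R_def dot_scale dot_sum case_prod_unfold)
    also have "\<dots> = c * (\<Sum>h\<in>{1..H}. \<Sum>s\<in>{h<..<t} - {H<..<t - H}. ?f h s t)"
      unfolding Z_def by (subst sum.Sigma) auto
    finally have R: "dot p (\<lambda>i. c * R t x i) (x t) = c * (\<Sum>h\<in>{1..H}. \<Sum>s\<in>{h<..<t} - {H<..<t - H}. ?f h s t)" .
    have "(\<Sum>s\<in>{h<..<t}. ?f h s t) = (\<Sum>s\<in>{h<..<t} - {H<..<t - H}. ?f h s t) + (\<Sum>s\<in>{H<..<t - H}. ?f h s t)"
      if "h \<in> {1..H}" for h
      using that by (intro sum.subset_diff) auto
    then show ?thesis
      unfolding F R by (simp add: sum.distrib algebra_simps)
  qed
  have "T_St_alt H p n x = c * (\<Sum>h\<in>{1..H}. a h * (\<Sum>t\<in>{1..n}. \<Sum>s\<in>{h<..<t}. dot p (x (s - h)) (x (t - h)) * dot p (x s) (x t)))"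
    unfolding T_St_alt_def sum_pairs by (simp add: c_def a_def real_sqrt_mult dot_def)
  also have "\<dots> = c * (\<Sum>h\<in>{1..H}. \<Sum>t\<in>{1..n}. \<Sum>s\<in>{h<..<t}. ?f h s t)"
    by (simp add: sum_distrib_left mult.assoc)
  also have "\<dots> = c * (\<Sum>t\<in>{1..n}. \<Sum>h\<in>{1..H}. \<Sum>s\<in>{h<..<t}. ?f h s t)"
    by (subst sum.swap) simp
  also have "\<dots> = (\<Sum>t\<in>{1..n}. dot p (F t x) (x t) + dot p (\<lambda>i. c * R t x i) (x t))"
    unfolding 1 by (simp add: sum_distrib_left)
  finally show ?thesis by (simp add: sum.distrib)
qed

text \<open>Cauchy-Schwarz over at most \<open>2 * H * H\<close> unit vectors, whose coefficients
  have second moment at most \<open>\<alpha>\<^sup>2 / p\<close>.\<close>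

lemma E_R:
  assumes "t \<le> n"
  shows "E (\<lambda>x. dot p (R t x) (R t x)) \<le> 4 * real H ^ 4 * \<alpha>\<^sup>2 / p"
proof -
  let ?q = "\<lambda>z x. a (fst z) * dot p (x (snd z - fst z)) (x (t - fst z))"
  have ind: "snd z - fst z \<in> {1..n}" "t - fst z \<in> {1..n}" "snd z - fst z \<noteq> t - fst z" "fst z \<in> {1..H}" "snd z \<in> {1..n}"
    if "z \<in> Z t" for z
    using that assms by (auto simp: Z_def)
  have "E (\<lambda>x. dot p (R t x) (R t x)) \<le> E (\<lambda>x. card (Z t) * (\<Sum>z\<in>Z t. (?q z x)\<^sup>2))"
  proof (rule E_mono_unit)
    show "adm (\<lambda>x. dot p (R t x) (R t x))" using assms by (intro adm_intros adm_R) auto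
    show "adm (\<lambda>x. card (Z t) * (\<Sum>z\<in>Z t. (?q z x)\<^sup>2))" using ind by (intro adm_intros) auto
    fix x :: "nat \<Rightarrow> nat \<Rightarrow> real"
    assume unit: "\<And>k. k \<in> {1..n} \<Longrightarrow> dot p (x k) (x k) = 1"
    have "dot p (R t x) (R t x) = (\<Sum>i<p. (\<Sum>z\<in>Z t. ?q z x * x (snd z) i)\<^sup>2)"
      by (simp add: dot_def R_def case_prod_unfold power2_eq_square)
    also have "\<dots> \<le> (\<Sum>i<p. (\<Sum>z\<in>Z t. (?q z x * x (snd z) i)\<^sup>2) * card (Z t))"
      by (intro sum_mono sum_squared_le_sum_of_squares) (rule finite_Z)?
    also have "\<dots> = card (Z t) * (\<Sum>i<p. \<Sum>z\<in>Z t. (?q z x * x (snd z) i)\<^sup>2)"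
      unfolding sum_distrib_right[symmetric] by (rule mult.commute)
    also have "(\<Sum>i<p. \<Sum>z\<in>Z t. (?q z x * x (snd z) i)\<^sup>2) = (\<Sum>z\<in>Z t. \<Sum>i<p. (?q z x)\<^sup>2 * (x (snd z) i)\<^sup>2)"
      unfolding power_mult_distrib by (rule sum.swap)
    also have "\<dots> = (\<Sum>z\<in>Z t. (?q z x)\<^sup>2 * dot p (x (snd z)) (x (snd z)))"
      by (simp add: sum_distrib_left[symmetric] dot_self)
    also have "\<dots> = (\<Sum>z\<in>Z t. (?q z x)\<^sup>2)"
      using unit[OF ind(5)] by simp
    finally show "dot p (R t x) (R t x) \<le> card (Z t) * (\<Sum>z\<in>Z t. (?q z x)\<^sup>2)" .
  qed
  also have "\<dots> = card (Z t) * (\<Sum>z\<in>Z t. (a (fst z))\<^sup>2 * E (\<lambda>x. (dot p (x (snd z - fst z)) (x (t - fst z)))\<^sup>2))"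
    unfolding power_mult_distrib Bochner_Integration.integral_mult_right_zero
    using ind by (subst E_sum) (auto intro!: adm_intros)
  also have "\<dots> \<le> card (Z t) * (\<Sum>z\<in>Z t. \<alpha>\<^sup>2 * (1 / p))"
  proof (intro mult_left_mono sum_mono mult_mono power_mono)
    fix z assume z: "z \<in> Z t"
    show "a (fst z) \<le> \<alpha>" "0 \<le> a (fst z)" using a_bounds[OF ind(4)[OF z]] by auto
    show "E (\<lambda>x. (dot p (x (snd z - fst z)) (x (t - fst z)))\<^sup>2) \<le> 1 / p"
      using E_dot_pair(1)[OF ind(1-3)[OF z]] by simp
  qed (auto intro: E_nonneg)
  also have "\<dots> = real (card (Z t)) ^ 2 * (\<alpha>\<^sup>2 / p)" by (simp add: power2_eq_square)
  also have "\<dots> \<le> (2 * real H * real H) ^ 2 * (\<alpha>\<^sup>2 / p)"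
    using of_nat_mono[OF card_Z[of t], where 'a=real] by (intro mult_right_mono power_mono) simp_all
  also have "\<dots> = 4 * real H ^ 4 * \<alpha>\<^sup>2 / p" by (simp add: power2_eq_square power4_eq_xxxx)
  finally show ?thesis .
qed

text \<open>\<open>R t\<close> is free of all times from \<open>t\<close> on, so the remainder is
  again a sum of orthogonal differences. The factor \<open>c\<^sup>2\<close> cancels both divisions
  by \<open>p\<close>, and the result is of order \<open>1 / n\<close>.\<close>

lemma E_remainder:
  "E (\<lambda>x. (\<Sum>t\<in>{1..n}. dot p (\<lambda>i. c * R t x i) (x t))\<^sup>2) \<le> 8 * real H ^ 3 * n * \<alpha>\<^sup>2"
proof -
  have "E (\<lambda>x. (\<Sum>t\<in>{1..n}. dot p (\<lambda>i. c * R t x i) (x t))\<^sup>2)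
     = (\<Sum>t\<in>{1..n}. E (\<lambda>x. dot p (\<lambda>i. c * R t x i) (\<lambda>i. c * R t x i))) / p"
  proof (rule E_square_sum)
    fix k l assume "l \<le> (k :: nat)"
    from free_R[OF this] show "free_of k (\<lambda>x i. c * R l x i)" by (simp add: free_of_def)
  qed (auto intro!: adm_intros adm_R)
  also have "\<dots> = (\<Sum>t\<in>{1..n}. c\<^sup>2 * E (\<lambda>x. dot p (R t x) (R t x))) / p"
    by (simp add: dot_scale power2_eq_square mult.assoc)
  also have "\<dots> \<le> (\<Sum>t\<in>{1..n}. c\<^sup>2 * (4 * real H ^ 4 * \<alpha>\<^sup>2 / p)) / p"
    by (intro divide_right_mono sum_mono mult_left_mono E_R) auto
  also have "\<dots> = 8 * real H ^ 3 * n * \<alpha>\<^sup>2"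
    unfolding c_sq using p_pos H1 by (simp add: field_simps power2_eq_square power3_eq_cube power4_eq_xxxx)
  finally show ?thesis .
qed

text \<open>The mean of the conditional variance of the \<open>t\<close>-th main difference: the
  cross terms of \<open>Y\<close> have mean zero and each square has mean \<open>b\<close>. It is 0
  for \<open>t \<le> 2 * H + 1\<close>, where no time is left between \<open>H\<close> and
  \<open>t - H\<close>.\<close>

definition \<delta> :: "nat \<Rightarrow> real" where "\<delta> t = c\<^sup>2 / p * (b * card {H<..<t - H})"

lemma \<alpha>_le: "\<alpha> \<le> 2 / n"
proof -
  have "real n \<le> 2 * real (n - H)" using nH by simp
  then show ?thesis using nH by (simp add: \<alpha>_def field_simps)
qed

lemma n_pos: "real n > 0" using nH by simp

text \<open>The dimension cancels: \<open>c\<^sup>2 / p\<close> is proportional to \<open>p\<close>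
  and \<open>\<beta>\<close> to \<open>1 / p\<close>. With \<open>Y\<close> of size
  \<open>\<beta> * n\<close>, the conditional variances are of order \<open>1 / n\<close> whatever
  \<open>p\<close> is.\<close>

lemma p\<beta>: "c\<^sup>2 / p * \<beta> \<le> 8 * sqrt 3 * H / (real n)\<^sup>2"
proof -
  have "c\<^sup>2 / p * \<beta> = 2 * sqrt 3 * H * \<alpha>\<^sup>2"
    unfolding c_sq_div using p_pos H1 by (simp add: \<beta>_def field_simps power2_eq_square)
  also have "\<dots> \<le> 2 * sqrt 3 * H * (2 / n)\<^sup>2"
    using \<alpha>_le \<alpha>_pos by (intro mult_left_mono power_mono) auto
  also have "\<dots> = 8 * sqrt 3 * H / (real n)\<^sup>2" by (simp add: power_divide)
  finally show ?thesis .
qed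

lemma \<delta>_bounds:
  assumes "t \<in> {1..n}"
  shows "0 \<le> \<delta> t \<and> \<delta> t \<le> 8 / n"
proof -
  have b0: "b \<ge> 0" by (simp add: b_def sum_nonneg)
  have "(\<Sum>h\<in>{1..H}. (a h)\<^sup>2) \<le> (\<Sum>h\<in>{1..H}. (2 / n)\<^sup>2)"
  proof (intro sum_mono power_mono)
    fix h assume "h \<in> {1..H}"
    then show "a h \<le> 2 / n" "0 \<le> a h" using a_bounds[of h] \<alpha>_le by auto
  qed
  then have s: "(\<Sum>h\<in>{1..H}. (a h)\<^sup>2) \<le> H * (4 / (real n)\<^sup>2)" by (simp add: power_divide)
  have "\<delta> t = 2 / H * (\<Sum>h\<in>{1..H}. (a h)\<^sup>2) * card {H<..<t - H}"
    unfolding \<delta>_def c_sq_div using p_pos by (simp add: b_def)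
  also have "\<dots> \<le> 2 / H * (H * (4 / (real n)\<^sup>2)) * n"
    using assms s by (intro mult_mono mult_nonneg_nonneg sum_nonneg) auto
  also have "\<dots> = 8 / n" using H1 n_pos by (simp add: power2_eq_square)
  finally show ?thesis using b0 by (simp add: \<delta>_def)
qed

lemma sum_\<delta>:
  "(\<Sum>t\<in>{1..n}. \<delta> t) = (\<Sum>h\<in>{1..H}. (real n - 2 * H - 1) * (real n - 2 * H) / (real n - h)\<^sup>2) / H"
proof -
  \<comment> \<open>The summand is zero up to \<open>t = 2 * H + 1\<close> and then grows by one
    with each \<open>t\<close>, which gives a triangular number; below,
    \<open>k = n - 2 * H - 1\<close>.\<close>
  have tri: "(\<Sum>t\<in>{1..2 * H + 1 + k}. real (card {H<..<t - H})) = real k * (real k + 1) / 2" for k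
  proof (induction k)
    case 0
    have "{H<..<t - H} = {}" if "t \<in> {1..2 * H + 1}" for t using that by auto
    then show ?case by simp
  next
    case (Suc k)
    then show ?case by (simp add: field_simps)
  qed
  have e: "n = 2 * H + 1 + (n - 2 * H - 1)" using nH by simp
  have "(\<Sum>t\<in>{1..n}. real (card {H<..<t - H})) = (real n - 2 * H - 1) * (real n - 2 * H) / 2"
    using tri[of "n - 2 * H - 1"] nH unfolding e[symmetric] by (simp add: of_nat_diff)
  moreover have "(\<Sum>t\<in>{1..n}. \<delta> t) = c\<^sup>2 / p * b * (\<Sum>t\<in>{1..n}. real (card {H<..<t - H}))"
    unfolding \<delta>_def by (simp add: sum_distrib_left mult.assoc)
  moreover have "c\<^sup>2 / p * b = 2 / H * (\<Sum>h\<in>{1..H}. 1 / (real n - h)\<^sup>2)"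
    unfolding c_sq_div using p_pos nH by (simp add: b_def a_def power_divide of_nat_diff)
  ultimately have "(\<Sum>t\<in>{1..n}. \<delta> t) = 2 / H * (\<Sum>h\<in>{1..H}. 1 / (real n - h)\<^sup>2) * ((real n - 2 * H - 1) * (real n - 2 * H) / 2)"
    by (simp only:)
  also have "\<dots> = (real n - 2 * H - 1) * (real n - 2 * H) * (\<Sum>h\<in>{1..H}. 1 / (real n - h)\<^sup>2) / H"
    by simp
  finally show ?thesis
    by (simp only: sum_distrib_left times_divide_eq_right mult_1_right)
qed

text \<open>The bound is \<open>1 / n\<close> times a quantity that vanishes as \<open>n\<close> and
  \<open>p\<close> grow, so the \<open>n\<close> replacements of a conditional variance by
  \<open>\<delta> t\<close> cost nothing in the limit.\<close>

lemma E_F_concentration: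
  assumes "t \<in> {1..n}"
  shows "E (\<lambda>x. \<bar>dot p (F t x) (F t x) / p - \<delta> t\<bar>) \<le> 8 * sqrt 3 * H * sqrt (24 / p + 4 * H / n) / n"
proof -
  let ?r = "sqrt (24 * (real n)\<^sup>2 / p + 4 * real H * n)"
  have rp: "?r > 0" using n_pos p_pos H1 by (auto intro!: add_pos_pos)
  have aY: "adm (\<lambda>x. Y t (t - H) x - b * card {H<..<t - H})"
    using assms by (intro adm_intros adm_W) auto
  have "E (\<lambda>x. \<bar>Y t (t - H) x - b * card {H<..<t - H}\<bar>) \<le> \<beta> * ?r"
    using assms aY \<beta>_pos rp by (intro E_abs_le E_Y_concentration) auto
  then have "c\<^sup>2 / p * E (\<lambda>x. \<bar>Y t (t - H) x - b * card {H<..<t - H}\<bar>) \<le> c\<^sup>2 / p * (\<beta> * ?r)"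
    by (intro mult_left_mono) auto
  also have "\<dots> = (c\<^sup>2 / p * \<beta>) * ?r" by simp
  also have "\<dots> \<le> 8 * sqrt 3 * H / (real n)\<^sup>2 * ?r"
    using rp by (intro mult_right_mono p\<beta>) auto
  also have "24 * (real n)\<^sup>2 / p + 4 * real H * n = (real n)\<^sup>2 * (24 / p + 4 * H / n)"
    using n_pos p_pos by (simp add: field_simps power2_eq_square)
  also have "sqrt \<dots> = n * sqrt (24 / p + 4 * H / n)"
    using n_pos by (simp add: real_sqrt_mult)
  also have "8 * sqrt 3 * H / (real n)\<^sup>2 * (n * sqrt (24 / p + 4 * H / n)) = 8 * sqrt 3 * H * sqrt (24 / p + 4 * H / n) / n"
    using n_pos by (simp add: power2_eq_square)
  also have "c\<^sup>2 / p * E (\<lambda>x. \<bar>Y t (t - H) x - b * card {H<..<t - H}\<bar>) = E (\<lambda>x. \<bar>dot p (F t x) (F t x) / p - \<delta> t\<bar>)"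
  proof -
    have "\<bar>dot p (F t x) (F t x) / p - \<delta> t\<bar> = c\<^sup>2 / p * \<bar>Y t (t - H) x - b * card {H<..<t - H}\<bar>" for x
    proof -
      have "dot p (F t x) (F t x) / p - \<delta> t = c\<^sup>2 / p * (Y t (t - H) x - b * card {H<..<t - H})"
        unfolding dot_F \<delta>_def by (simp add: algebra_simps)
      then show ?thesis by (simp add: abs_mult)
    qed
    then show ?thesis by simp
  qed
  finally show ?thesis .
qed

lemma E_Y2':
  assumes "t \<in> {1..n}"
  shows "E (\<lambda>x. (Y t (t - H) x)\<^sup>2) \<le> (3 * \<beta> * n)\<^sup>2"
proof (cases "H < t - H")
  case True
  then have "E (\<lambda>x. (Y t (t - H) x)\<^sup>2) \<le> (3 * \<beta> * (t - H))\<^sup>2"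
    using assms by (intro E_Y2) auto
  also have "\<dots> \<le> (3 * \<beta> * n)\<^sup>2"
    using assms \<beta>_pos by (intro power_mono mult_left_mono) auto
  finally show ?thesis .
next
  case False
  then have "{H<..<t - H} = {}" by auto
  then show ?thesis by (simp add: W_def dot_def)
qed

lemma E_D2:
  assumes "t \<in> {1..n}"
  shows "E (\<lambda>x. (dot p (F t x) (x t))\<^sup>2) \<le> 24 * sqrt 3 * H / n"
proof -
  have "E (\<lambda>x. 1 * (dot p (F t x) (x t))\<^sup>2) = E (\<lambda>x. 1 * dot p (F t x) (F t x)) / p"
    using assms by (intro E_square adm_F free_F adm_const) (auto simp: free_of_def)
  also have "\<dots> = c\<^sup>2 / p * E (\<lambda>x. Y t (t - H) x)" by (simp add: dot_F)
  also have "\<dots> \<le> c\<^sup>2 / p * (3 * \<beta> * n)"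
  proof (intro mult_left_mono)
    have "E (\<lambda>x. \<bar>Y t (t - H) x\<bar>) \<le> 3 * \<beta> * n"
      using assms \<beta>_pos n_pos by (intro E_abs_le adm_Y E_Y2') auto
    then show "E (\<lambda>x. Y t (t - H) x) \<le> 3 * \<beta> * n" by (simp add: dot_nonneg)
  qed auto
  also have "\<dots> = (c\<^sup>2 / p * \<beta>) * (3 * n)" by simp
  also have "\<dots> \<le> 8 * sqrt 3 * H / (real n)\<^sup>2 * (3 * n)"
    by (intro mult_right_mono p\<beta>) auto
  also have "\<dots> = 24 * sqrt 3 * H / n" using n_pos by (simp add: power2_eq_square)
  finally show ?thesis by simp
qed

text \<open>The square of the order \<open>1 / n\<close> of the second moment, as for a normal
  variable; \<open>5184 = 27 * (8 * sqrt 3)\<^sup>2\<close>.\<close>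

lemma E_D4:
  assumes "t \<in> {1..n}"
  shows "E (\<lambda>x. dot p (F t x) (x t) ^ 4) \<le> 5184 * (real H)\<^sup>2 / (real n)\<^sup>2"
proof -
  have "E (\<lambda>x. dot p (F t x) (x t) ^ 4) \<le> 3 / (real p)\<^sup>2 * E (\<lambda>x. (dot p (F t x) (F t x))\<^sup>2)"
    using assms by (intro E_fourth[of t "F t"] adm_F free_F) auto
  also have "\<dots> = 3 * (c\<^sup>2 / p)\<^sup>2 * E (\<lambda>x. (Y t (t - H) x)\<^sup>2)"
    by (simp add: dot_F power_mult_distrib power_divide)
  also have "\<dots> \<le> 3 * (c\<^sup>2 / p)\<^sup>2 * (3 * \<beta> * n)\<^sup>2"
    by (intro mult_left_mono E_Y2' assms) auto
  also have "\<dots> = 27 * (real n)\<^sup>2 * (c\<^sup>2 / p * \<beta>)\<^sup>2" by (simp add: power_mult_distrib power_divide)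
  also have "\<dots> \<le> 27 * (real n)\<^sup>2 * (8 * sqrt 3 * H / (real n)\<^sup>2)\<^sup>2"
    using \<beta>_pos by (intro mult_left_mono power_mono p\<beta>) auto
  also have "\<dots> = 5184 * (real H)\<^sup>2 / (real n)\<^sup>2"
    using n_pos by (simp add: power_mult_distrib power_divide power2_eq_square)
  finally show ?thesis .
qed

text \<open>The first three error terms come from \<open>E_cos_martingale\<close>, the last from
  dropping \<open>R\<close>. Only the first involves \<open>p\<close>, and all four vanish as
  \<open>n\<close> and \<open>p\<close> grow.\<close>

lemma E_cos_T_St_alt:
  "\<bar>E (\<lambda>x. cos (\<theta> + u * T_St_alt H p n x))
     - exp (- (u\<^sup>2 * ((\<Sum>h\<in>{1..H}. (real n - 2 * H - 1) * (real n - 2 * H) / (real n - h)\<^sup>2) / H) / 2)) * cos \<theta>\<bar>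
    \<le> u\<^sup>2 / 2 * (8 * sqrt 3 * H * sqrt (24 / p + 4 * H / n))
      + \<bar>u\<bar> ^ 3 / 12 * ((24 * sqrt 3 * H + 5184 * (real H)\<^sup>2) / sqrt n) + u ^ 4 * 8 / n
      + \<bar>u\<bar> * sqrt (32 * real H ^ 3 / n)"
proof -
  let ?S = "\<lambda>x. \<Sum>t\<in>{1..n}. dot p (F t x) (x t)"
  let ?Q = "\<lambda>x. \<Sum>t\<in>{1..n}. dot p (\<lambda>i. c * R t x i) (x t)"
  have aS: "adm ?S" "adm ?Q" by (intro adm_intros adm_F adm_R; simp)+
  have "E (\<lambda>x. (?Q x)\<^sup>2) \<le> (sqrt (32 * real H ^ 3 / n))\<^sup>2"
  proof -
    have "8 * real H ^ 3 * n * \<alpha>\<^sup>2 \<le> 8 * real H ^ 3 * n * (2 / n)\<^sup>2"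
      using \<alpha>_le \<alpha>_pos by (intro mult_left_mono power_mono) auto
    also have "\<dots> = (sqrt (32 * real H ^ 3 / n))\<^sup>2" using n_pos by (simp add: power2_eq_square)
    finally show ?thesis using E_remainder by linarith
  qed
  then have "E (\<lambda>x. \<bar>?Q x\<bar>) \<le> sqrt (32 * real H ^ 3 / n)"
    using H1 n_pos by (intro E_abs_le aS) auto
  then have 1: "\<bar>E (\<lambda>x. cos (\<theta> + u * (?S x + ?Q x))) - E (\<lambda>x. cos (\<theta> + u * ?S x))\<bar> \<le> \<bar>u\<bar> * sqrt (32 * real H ^ 3 / n)"
    by (intro order_trans[OF E_cos_perturb[OF aS]] mult_left_mono) auto
  \<comment> \<open>Here \<open>\<eta> = 1 / sqrt n\<close>, which brings both parts of the cubic
    remainder to order \<open>n\<close> to the power \<open>-3/2\<close> per step.\<close>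
  have 2: "\<bar>E (\<lambda>x. cos (\<theta> + u * ?S x)) - exp (- (u\<^sup>2 * (\<Sum>t\<in>{1..n}. \<delta> t) / 2)) * cos \<theta>\<bar>
    \<le> real n * (u\<^sup>2 / 2 * (8 * sqrt 3 * H * sqrt (24 / p + 4 * H / n) / n)
      + \<bar>u\<bar> ^ 3 / 12 * ((1 / sqrt n) * (24 * sqrt 3 * H / n) + (5184 * (real H)\<^sup>2 / (real n)\<^sup>2) / (1 / sqrt n))
      + u ^ 4 * (8 / n)\<^sup>2 / 8)"
    using n_pos by (intro E_cos_martingale adm_F free_F \<delta>_bounds E_F_concentration E_D2 E_D4) auto
  have "sqrt n * sqrt n = real n" using n_pos by simp
  then have 3: "real n * ((1 / sqrt n) * (24 * sqrt 3 * H / n) + (5184 * (real H)\<^sup>2 / (real n)\<^sup>2) / (1 / sqrt n))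
    = (24 * sqrt 3 * H + 5184 * (real H)\<^sup>2) / sqrt n"
    using n_pos by (simp add: field_simps power2_eq_square)
  have "real n * (A / n) = A" for A using n_pos by simp
  then have "real n * (u\<^sup>2 / 2 * (8 * sqrt 3 * H * sqrt (24 / p + 4 * H / n) / n)
      + \<bar>u\<bar> ^ 3 / 12 * ((1 / sqrt n) * (24 * sqrt 3 * H / n) + (5184 * (real H)\<^sup>2 / (real n)\<^sup>2) / (1 / sqrt n))
      + u ^ 4 * (8 / n)\<^sup>2 / 8)
     = u\<^sup>2 / 2 * (8 * sqrt 3 * H * sqrt (24 / p + 4 * H / n))
      + \<bar>u\<bar> ^ 3 / 12 * ((24 * sqrt 3 * H + 5184 * (real H)\<^sup>2) / sqrt n) + u ^ 4 * 8 / n"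
    unfolding 3[symmetric] using n_pos by (simp add: algebra_simps power2_eq_square)
  then show ?thesis
    using 1 2 unfolding T_St_alt_decomp sum_\<delta> by linarith
qed

end

section \<open>Identification of the statistic and convergence in distribution\<close>

lemma shifted_ratio_tendsto_1: "(\<lambda>n. (real n - a) / (real n - h)) \<longlonglongrightarrow> 1"
proof -
  have "filterlim (\<lambda>n. - h + real n) at_top sequentially"
    by (rule filterlim_tendsto_add_at_top[OF tendsto_const filterlim_real_sequentially])
  then have "(\<lambda>n. 1 + (h - a) / (- h + real n)) \<longlonglongrightarrow> 1 + 0"
    by (intro tendsto_add tendsto_const tendsto_divide_0[OF tendsto_const] filterlim_at_top_imp_at_infinity)
  moreover have "eventually (\<lambda>n. 1 + (h - a) / (- h + real n) = (real n - a) / (real n - h)) sequentially"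
    using eventually_gt_at_top[of "nat \<lceil>h\<rceil>"]
  proof eventually_elim
    case (elim n)
    then have "real n > h" by linarith
    then show ?case by (simp add: field_simps)
  qed
  ultimately show ?thesis by (simp add: tendsto_cong)
qed

section \<open>Frobenius norms as double sums of scalar products\<close>

lemma sum_square_symmetric:
  fixes g :: "nat \<Rightarrow> nat \<Rightarrow> real"
  assumes sym: "\<And>s t. g s t = g t s"
  shows "(\<Sum>s\<in>{h+1..m}. \<Sum>t\<in>{h+1..m}. g s t)
    = (\<Sum>s\<in>{h+1..m}. g s s) + 2 * (\<Sum>t\<in>{1..m}. \<Sum>s\<in>{h<..<t}. g s t)"
proof (induction m)
  case 0
  then show ?case by simp
next
  case (Suc m)
  show ?case
  proof (cases "h < Suc m")
    case True
    have e: "{h<..<Suc m} = {h+1..m}" by auto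
    have i: "{h+1..Suc m} = insert (Suc m) {h+1..m}" using True by auto
    have "(\<Sum>t\<in>{h+1..m}. g (Suc m) t) = (\<Sum>t\<in>{h+1..m}. g t (Suc m))"
      by (simp add: sym)
    then show ?thesis using Suc unfolding i by (simp add: sum.distrib e)
  next
    case False
    have "{h<..<t} = {}" if "t \<in> {1..Suc m}" for t using that False by auto
    then show ?thesis using False by simp
  qed
qed

text \<open>The Frobenius product of two rank-one matrices is a product of two scalar products. The
  \<open>n - h\<close> diagonal terms equal 1 for unit vectors and give the centering
  \<open>p\<^sup>2\<close>; the others occur twice by symmetry.\<close>

lemma frob_sq_r_mat:
  assumes "h < n" and unit: "\<And>t. t \<in> {1..n} \<Longrightarrow> dot p (U t) (U t) = 1"
  shows "real (n - h) * frob_sq p (r_mat p n h U) = (real p)\<^sup>2 + 2 * (real p)\<^sup>2 / real (n - h) *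
    (\<Sum>t\<in>{1..n}. \<Sum>s\<in>{h<..<t}. dot p (U (s - h)) (U (t - h)) * dot p (U s) (U t))"
proof -
  let ?J = "{h+1..n}"
  let ?g = "\<lambda>s t. dot p (U (s - h)) (U (t - h)) * dot p (U s) (U t)"
  have "(\<Sum>i<p. \<Sum>j<p. (\<Sum>t\<in>?J. U t i * U (t - h) j)\<^sup>2)
      = (\<Sum>(i, j)\<in>{..<p} \<times> {..<p}. \<Sum>(s, t)\<in>?J \<times> ?J. (U s i * U (s - h) j) * (U t i * U (t - h) j))"
    unfolding sum.cartesian_product[of _ "{..<p}" "{..<p}"]
    by (intro sum.cong refl) (auto simp: power2_eq_square sum_product sum.cartesian_product)
  also have "\<dots> = (\<Sum>(s, t)\<in>?J \<times> ?J. \<Sum>(i, j)\<in>{..<p} \<times> {..<p}. (U s i * U (s - h) j) * (U t i * U (t - h) j))"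
    unfolding case_prod_unfold by (rule sum.swap)
  also have "\<dots> = (\<Sum>(s, t)\<in>?J \<times> ?J. ?g s t)"
  proof (rule sum.cong[OF refl], clarify)
    fix s t
    have "dot p (U s) (U t) * dot p (U (s - h)) (U (t - h))
      = (\<Sum>(i, j)\<in>{..<p} \<times> {..<p}. (U s i * U t i) * (U (s - h) j * U (t - h) j))"
      by (simp add: dot_def sum_product sum.cartesian_product)
    then show "(\<Sum>(i, j)\<in>{..<p} \<times> {..<p}. (U s i * U (s - h) j) * (U t i * U (t - h) j)) = ?g s t"
      by (simp add: mult_ac)
  qed
  also have "\<dots> = (\<Sum>s\<in>?J. \<Sum>t\<in>?J. ?g s t)"
    by (simp add: sum.cartesian_product)
  also have "\<dots> = (\<Sum>s\<in>?J. ?g s s) + 2 * (\<Sum>t\<in>{1..n}. \<Sum>s\<in>{h<..<t}. ?g s t)"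
    by (rule sum_square_symmetric) (simp add: dot_commute)
  also have "(\<Sum>s\<in>?J. ?g s s) = (\<Sum>s\<in>?J. 1)"
  proof (rule sum.cong[OF refl])
    fix s assume "s \<in> ?J"
    then have "s \<in> {1..n}" "s - h \<in> {1..n}" by auto
    then show "?g s s = 1" by (simp add: unit del: atLeastAtMost_iff)
  qed
  also have "\<dots> = real (n - h)" by simp
  finally have eq: "(\<Sum>i<p. \<Sum>j<p. (\<Sum>t\<in>?J. U t i * U (t - h) j)\<^sup>2)
     = real (n - h) + 2 * (\<Sum>t\<in>{1..n}. \<Sum>s\<in>{h<..<t}. ?g s t)" .
  have alg: "d > 0 \<Longrightarrow> d * ((q / d)\<^sup>2 * (d + 2 * S)) = q\<^sup>2 + 2 * q\<^sup>2 / d * S" for d q S :: real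
    by (simp add: power2_eq_square field_simps)
  have f: "frob_sq p (r_mat p n h U) = (real p / real (n - h))\<^sup>2 * (\<Sum>i<p. \<Sum>j<p. (\<Sum>t\<in>?J. U t i * U (t - h) j)\<^sup>2)"
    by (simp only: frob_sq_def r_mat_def power_mult_distrib sum_distrib_left[symmetric])
  show ?thesis
    unfolding f eq by (rule alg) (use assms(1) in simp)
qed

lemma T_St_eq_alt:
  assumes "H < n" "p > 0" "H \<ge> 1" and unit: "\<And>t. t \<in> {1..n} \<Longrightarrow> dot p (U t) (U t) = 1"
  shows "T_St H p n U = T_St_alt H p n U"
proof -
  let ?q = "\<lambda>h. \<Sum>t\<in>{1..n}. \<Sum>s\<in>{h<..<t}. dot p (U (s - h)) (U (t - h)) * dot p (U s) (U t)"
  let ?S = "\<Sum>h\<in>{1..H}. 1 / real (n - h) * ?q h"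
  have "T_stat H p n U = (\<Sum>h\<in>{1..H}. (real p)\<^sup>2 + 2 * (real p)\<^sup>2 * (1 / real (n - h) * ?q h))"
    unfolding T_stat_def
  proof (rule sum.cong[OF refl])
    fix h assume "h \<in> {1..H}"
    then have "h < n" using assms(1) by simp
    from frob_sq_r_mat[of h n p U, OF this unit]
    show "real (n - h) * frob_sq p (r_mat p n h U) = (real p)\<^sup>2 + 2 * (real p)\<^sup>2 * (1 / real (n - h) * ?q h)"
      by simp
  qed
  also have "\<dots> = real H * (real p)\<^sup>2 + 2 * (real p)\<^sup>2 * ?S"
    by (simp only: sum.distrib sum_distrib_left sum_constant card_atLeastAtMost) simp
  finally have T: "T_stat H p n U - real H * (real p)\<^sup>2 = 2 * (real p)\<^sup>2 * ?S" by simp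
  have A: "T_St_alt H p n U = sqrt (2 * (real p)\<^sup>2) / sqrt (real H) * ?S"
    unfolding T_St_alt_def sum_pairs dot_def ..
  have "sqrt 2 * sqrt 2 = (2 :: real)" by simp
  then have k: "2 * (real p)\<^sup>2 / sqrt (2 * real H * (real p)\<^sup>2) = sqrt (2 * (real p)\<^sup>2) / sqrt (real H)"
    using assms by (simp add: real_sqrt_mult field_simps power2_eq_square)
  show ?thesis
    unfolding T_St_def T A k[symmetric] by (simp only: times_divide_eq_left)
qed

text \<open>A point of the product space carries vectors for the times 1 to \<open>n\<close> only.
  The statistic reads no others, since \<open>h + 1 \<le> s\<close> keeps \<open>s - h\<close>
  positive.\<close>

lemma T_St_alt_cong:
  assumes "\<And>t. t \<in> {1..n} \<Longrightarrow> U t = V t"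
  shows "T_St_alt H p n U = T_St_alt H p n V"
proof -
  have eq: "U (s - h) = V (s - h) \<and> U s = V s" if "h < s" "s \<le> n" for s h
  proof -
    have "s - h \<in> {1..n}" "s \<in> {1..n}" using that by auto
    then show ?thesis using assms by blast
  qed
  have "(\<Sum>(s, t)\<in>{(s, t). h + 1 \<le> s \<and> s < t \<and> t \<le> n}. (\<Sum>i<p. U (s - h) i * U (t - h) i) * (\<Sum>i<p. U s i * U t i))
    = (\<Sum>(s, t)\<in>{(s, t). h + 1 \<le> s \<and> s < t \<and> t \<le> n}. (\<Sum>i<p. V (s - h) i * V (t - h) i) * (\<Sum>i<p. V s i * V t i))" for h
  proof (rule sum.cong[OF refl], clarify)
    fix s t assume st: "h + 1 \<le> s" "s < t" "t \<le> n"
    then have "U (s - h) = V (s - h) \<and> U s = V s" "U (t - h) = V (t - h) \<and> U t = V t"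
      using eq[of h s] eq[of h t] by auto
    then show "(\<Sum>i<p. U (s - h) i * U (t - h) i) * (\<Sum>i<p. U s i * U t i)
      = (\<Sum>i<p. V (s - h) i * V (t - h) i) * (\<Sum>i<p. V s i * V t i)" by simp
  qed
  then show ?thesis unfolding T_St_alt_def by simp
qed

section \<open>Transfer from the product space to one row of the array\<close>

locale directional_sample =
  fixes n p H :: nat and M :: "'a measure" and X :: "nat \<Rightarrow> 'a \<Rightarrow> nat \<Rightarrow> real"
  assumes p1: "p > 0" and H_pos: "H \<ge> 1"
    and M_prob: "prob_space M"
    and X_meas: "\<And>t. t \<in> {1..n} \<Longrightarrow> X t \<in> measurable M (RV p)"
    and X_indep: "prob_space.indep_vars M (\<lambda>_. RV p) X {1..n}"
    and X_ident: "\<And>t. t \<in> {1..n} \<Longrightarrow> distr M (RV p) (X t) = distr M (RV p) (X 1)"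
    and X_sph: "n \<ge> 1 \<Longrightarrow> spherical_directions p (distr M (RV p) (X 1))"
begin

abbreviation U :: "'a \<Rightarrow> nat \<Rightarrow> nat \<Rightarrow> real" where
  "U \<omega> \<equiv> \<lambda>t. unit_dir p (X t \<omega>)"

lemma measurable_U: "t \<in> {1..n} \<Longrightarrow> (\<lambda>\<omega>. U \<omega> t) \<in> measurable M (RV p)"
  by (rule measurable_compose[OF X_meas measurable_unit_dir])

lemma measurable_U_coord: "t \<in> {1..n} \<Longrightarrow> i < p \<Longrightarrow> (\<lambda>\<omega>. U \<omega> t i) \<in> borel_measurable M"
  by (rule measurable_compose[OF measurable_U measurable_RV_component])

lemma measurable_T: "(\<lambda>\<omega>. T_St H p n (U \<omega>)) \<in> borel_measurable M"
proof -
  have r: "(\<lambda>\<omega>. r_mat p n h (U \<omega>) i j) \<in> borel_measurable M" if ij: "i < p" "j < p" for h i j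
    unfolding r_mat_def
  proof (rule borel_measurable_times[OF measurable_const borel_measurable_sum])
    fix t assume t: "t \<in> {h+1..n}"
    have "t \<in> {1..n}" "t - h \<in> {1..n}" using t by auto
    then show "(\<lambda>\<omega>. U \<omega> t i * U \<omega> (t - h) j) \<in> borel_measurable M"
      by (intro borel_measurable_times measurable_U_coord ij)
  qed simp
  have f: "(\<lambda>\<omega>. frob_sq p (r_mat p n h (U \<omega>))) \<in> borel_measurable M" for h
    unfolding frob_sq_def by (intro borel_measurable_sum borel_measurable_power r) auto
  show ?thesis
    unfolding T_St_def T_stat_def
    by (rule borel_measurable_divide[OF borel_measurable_diff[OF borel_measurable_sum]])
       (intro borel_measurable_times measurable_const f; simp)+
qed

lemma AE_unit: "AE \<omega> in M. \<forall>t\<in>{1..n}. dot p (U \<omega> t) (U \<omega> t) = 1"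
proof (rule eventually_ball_finite)
  show "\<forall>t\<in>{1..n}. AE \<omega> in M. dot p (U \<omega> t) (U \<omega> t) = 1"
  proof
    fix t assume t: "t \<in> {1..n}"
    then interpret spherical p "distr M (RV p) (X 1)"
      using X_sph p1 by unfold_locales auto
    have "AE x in distr M (RV p) (X t). vnorm p x > 0" unfolding X_ident[OF t] by (rule AE_N_pos)
    then have "AE \<omega> in M. vnorm p (X t \<omega>) > 0"
      by (rule AE_distrD[OF X_meas[OF t]])
    then show "AE \<omega> in M. dot p (U \<omega> t) (U \<omega> t) = 1"
      by eventually_elim (rule dot_unit_dir)
  qed
qed simp

lemma AE_T_St_eq_alt: "n > H \<Longrightarrow> AE \<omega> in M. T_St H p n (U \<omega>) = T_St_alt H p n (U \<omega>)"
proof -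
  assume n: "n > H"
  show ?thesis
    using AE_unit by eventually_elim (rule T_St_eq_alt[OF n p1 H_pos], blast)
qed

text \<open>Normalization preserves independence, which makes the joint law a product, and the
  common law of the vectors gives equal factors.\<close>

lemma distr_U:
  assumes "n \<ge> 1"
  shows "distr M (PiM {1..n} (\<lambda>_. RV p)) (\<lambda>\<omega>. \<lambda>t\<in>{1..n}. U \<omega> t)
    = PiM {1..n} (\<lambda>_. spherical.dir p (distr M (RV p) (X 1)))"
proof -
  interpret prob_space M by (rule M_prob)
  interpret sph: spherical p "distr M (RV p) (X 1)"
    using X_sph p1 assms by unfold_locales auto
  have "indep_vars (\<lambda>_. RV p) (\<lambda>t \<omega>. U \<omega> t) {1..n}"
    using indep_vars_compose2[OF X_indep, of "\<lambda>_. unit_dir p" "\<lambda>_. RV p"] by simp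
  then have "distr M (PiM {1..n} (\<lambda>_. RV p)) (\<lambda>\<omega>. \<lambda>t\<in>{1..n}. U \<omega> t)
      = PiM {1..n} (\<lambda>t. distr M (RV p) (\<lambda>\<omega>. U \<omega> t))"
    using assms measurable_U by (subst (asm) indep_vars_iff_distr_eq_PiM') auto
  also have "\<dots> = PiM {1..n} (\<lambda>_. sph.dir)"
  proof (rule PiM_cong[OF refl])
    fix t assume t: "t \<in> {1..n}"
    have "distr M (RV p) (\<lambda>\<omega>. U \<omega> t) = distr (distr M (RV p) (X t)) (RV p) (unit_dir p)"
      using X_meas[OF t] by (subst distr_distr) (auto simp: comp_def)
    then show "distr M (RV p) (\<lambda>\<omega>. U \<omega> t) = sph.dir"
      unfolding sph.dir_def X_ident[OF t] .
  qed
  finally show ?thesis .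
qed

lemma integral_cos_T_St:
  assumes "n > 2 * H"
  shows "\<bar>(\<integral>\<omega>. cos (\<theta> + u * T_St H p n (U \<omega>)) \<partial>M)
     - exp (- (u\<^sup>2 * ((\<Sum>h\<in>{1..H}. (real n - 2 * H - 1) * (real n - 2 * H) / (real n - h)\<^sup>2) / H) / 2)) * cos \<theta>\<bar>
    \<le> u\<^sup>2 / 2 * (8 * sqrt 3 * H * sqrt (24 / p + 4 * H / n))
      + \<bar>u\<bar> ^ 3 / 12 * ((24 * sqrt 3 * H + 5184 * (real H)\<^sup>2) / sqrt n) + u ^ 4 * 8 / n
      + \<bar>u\<bar> * sqrt (32 * real H ^ 3 / n)"
proof -
  interpret lagged_sample p "distr M (RV p) (X 1)" n H
    using X_sph p1 H_pos assms by unfold_locales auto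
  have Pd: "P = distr M (PiM {1..n} (\<lambda>_. RV p)) (\<lambda>\<omega>. \<lambda>t\<in>{1..n}. U \<omega> t)"
    using assms unfolding P_def by (subst distr_U) auto
  let ?f = "\<lambda>x. cos (\<theta> + u * T_St_alt H p n x)"
  have "adm ?f"
    unfolding T_St_alt_decomp by (intro adm_intros adm_F adm_R; simp)
  then have mf: "?f \<in> borel_measurable (PiM {1..n} (\<lambda>_. RV p))"
    using adm_measurable[of ?f] unfolding Pd by simp
  have mU: "(\<lambda>\<omega>. \<lambda>t\<in>{1..n}. U \<omega> t) \<in> measurable M (PiM {1..n} (\<lambda>_. RV p))"
    using measurable_U by (intro measurable_restrict) auto
  have mT: "(\<lambda>\<omega>. ?f (\<lambda>t\<in>{1..n}. U \<omega> t)) \<in> borel_measurable M"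
    by (rule measurable_compose[OF mU mf])
  have "E ?f = (\<integral>\<omega>. ?f (\<lambda>t\<in>{1..n}. U \<omega> t) \<partial>M)"
    unfolding Pd by (rule integral_distr[OF mU mf])
  \<comment> \<open>Restricting to the times 1 to \<open>n\<close> leaves the double-sum form
    unchanged, and that form agrees with the standardized statistic almost surely.\<close>
  also have "\<dots> = (\<integral>\<omega>. cos (\<theta> + u * T_St H p n (U \<omega>)) \<partial>M)"
  proof (rule integral_cong_AE[OF mT])
    show "(\<lambda>\<omega>. cos (\<theta> + u * T_St H p n (U \<omega>))) \<in> borel_measurable M"
      using measurable_T by simp
    have "n > H" using assms by simp
    from AE_T_St_eq_alt[OF this]
    show "AE \<omega> in M. ?f (\<lambda>t\<in>{1..n}. U \<omega> t) = cos (\<theta> + u * T_St H p n (U \<omega>))"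
    proof eventually_elim
      case (elim \<omega>)
      have "T_St_alt H p n (\<lambda>t\<in>{1..n}. U \<omega> t) = T_St_alt H p n (U \<omega>)"
        by (rule T_St_alt_cong) simp
      then show ?case using elim by simp
    qed
  qed
  finally show ?thesis using E_cos_T_St_alt[of \<theta> u] by simp
qed

end

theorem theorem4:
  fixes H :: nat and p :: "nat \<Rightarrow> nat"
    and M :: "nat \<Rightarrow> 'a measure"
    and X :: "nat \<Rightarrow> nat \<Rightarrow> 'a \<Rightarrow> (nat \<Rightarrow> real)"
  assumes H: "H \<ge> 1"
    and p_pos: "\<forall>n. p n > 0"
    and p_lim: "filterlim p at_top sequentially"
    and M_prob: "\<forall>n. prob_space (M n)"
    and X_meas: "\<forall>n. \<forall>t\<in>{1..n}. X n t \<in> measurable (M n) (RV (p n))"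
    and X_indep: "\<forall>n. prob_space.indep_vars (M n) (\<lambda>_. RV (p n)) (X n) {1..n}"
    and X_ident: "\<forall>n. \<forall>t\<in>{1..n}. distr (M n) (RV (p n)) (X n t) = distr (M n) (RV (p n)) (X n 1)"
    and X_sph: "\<forall>n\<ge>1. spherical_directions (p n) (distr (M n) (RV (p n)) (X n 1))"
  shows "(\<forall>n>H. AE \<omega> in M n.
            T_St H (p n) n (\<lambda>t. unit_dir (p n) (X n t \<omega>))
          = T_St_alt H (p n) n (\<lambda>t. unit_dir (p n) (X n t \<omega>)))
       \<and> weak_conv_m (\<lambda>n. distr (M n) borel (\<lambda>\<omega>. T_St H (p n) n (\<lambda>t. unit_dir (p n) (X n t \<omega>))))
           std_normal_distribution"
proof
  have smp: "directional_sample n (p n) H (M n) (X n)" for n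
    by (rule directional_sample.intro) (use assms in blast)+
  show "\<forall>n>H. AE \<omega> in M n.
            T_St H (p n) n (\<lambda>t. unit_dir (p n) (X n t \<omega>))
          = T_St_alt H (p n) n (\<lambda>t. unit_dir (p n) (X n t \<omega>))"
    using directional_sample.AE_T_St_eq_alt[OF smp] by blast
  define T where "T n \<omega> = T_St H (p n) n (\<lambda>t. unit_dir (p n) (X n t \<omega>))" for n \<omega>
  have mT: "T n \<in> borel_measurable (M n)" for n
    unfolding T_def by (rule directional_sample.measurable_T[OF smp])
  have p_inf: "filterlim (\<lambda>n. real (p n)) at_top sequentially"
    by (rule filterlim_compose[OF filterlim_real_sequentially p_lim])
  \<comment> \<open>The limit is the mean of \<open>cos (\<theta> + u * G)\<close> for a standard
    normal \<open>G\<close>. The phases 0 and \<open>- pi / 2\<close> yield the real and imaginary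
    parts of the characteristic function, so the estimates stay real.\<close>
  have cos_lim: "(\<lambda>n. \<integral>\<omega>. cos (\<theta> + u * T n \<omega>) \<partial>M n) \<longlonglongrightarrow> exp (- u\<^sup>2 / 2) * cos \<theta>" for \<theta> u :: real
  proof -
    \<comment> \<open>\<open>v n\<close> is the sum of the \<open>\<delta> t\<close>
      (\<open>sum_\<delta>\<close>), the total variance of the normal approximation: an average of
      \<open>H\<close> terms that each tend to 1.\<close>
    define v where "v n = (\<Sum>h\<in>{1..H}. (real n - 2 * H - 1) * (real n - 2 * H) / (real n - h)\<^sup>2) / H" for n
    define e where "e n = u\<^sup>2 / 2 * (8 * sqrt 3 * H * sqrt (24 / p n + 4 * H / n))
      + \<bar>u\<bar> ^ 3 / 12 * ((24 * sqrt 3 * H + 5184 * (real H)\<^sup>2) / sqrt n) + u ^ 4 * 8 / n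
      + \<bar>u\<bar> * sqrt (32 * real H ^ 3 / n)" for n
    have "(\<lambda>n. (real n - 2 * real H - 1) * (real n - 2 * real H) / (real n - real h)\<^sup>2) \<longlonglongrightarrow> 1" for h
      using tendsto_mult[OF shifted_ratio_tendsto_1[of "2 * real H + 1" "real h"] shifted_ratio_tendsto_1[of "2 * real H" "real h"]]
      by (simp add: power2_eq_square diff_diff_eq)
    then have "v \<longlonglongrightarrow> (\<Sum>h\<in>{1..H}. 1) / H"
      unfolding v_def using H by (intro tendsto_intros) auto
    then have v: "v \<longlonglongrightarrow> 1" using H by simp
    have "(\<lambda>n. 24 / real (p n) + 4 * H / n) \<longlonglongrightarrow> 0 + 0"
      by (intro tendsto_add tendsto_divide_0[OF tendsto_const] filterlim_at_top_imp_at_infinity p_inf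
          filterlim_real_sequentially)
    then have s1: "(\<lambda>n. sqrt (24 / real (p n) + 4 * H / n)) \<longlonglongrightarrow> 0"
      using tendsto_real_sqrt by fastforce
    have s2: "(\<lambda>n. (24 * sqrt 3 * H + 5184 * (real H)\<^sup>2) / sqrt (real n)) \<longlonglongrightarrow> 0"
      by (intro tendsto_divide_0[OF tendsto_const] filterlim_at_top_imp_at_infinity
          filterlim_compose[OF sqrt_at_top filterlim_real_sequentially])
    have s3: "(\<lambda>n. u ^ 4 * 8 / real n) \<longlonglongrightarrow> 0" by (rule lim_const_over_n)
    have "(\<lambda>n. 32 * real H ^ 3 / real n) \<longlonglongrightarrow> 0" by (rule lim_const_over_n)
    then have s4: "(\<lambda>n. sqrt (32 * real H ^ 3 / real n)) \<longlonglongrightarrow> 0"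
      using tendsto_real_sqrt by fastforce
    have "e \<longlonglongrightarrow> u\<^sup>2 / 2 * (8 * sqrt 3 * H * 0) + \<bar>u\<bar> ^ 3 / 12 * 0 + 0 + \<bar>u\<bar> * 0"
      unfolding e_def by (intro tendsto_add tendsto_mult tendsto_const s1 s2 s3 s4)
    then have e: "e \<longlonglongrightarrow> 0" by simp
    have "eventually (\<lambda>n. norm ((\<integral>\<omega>. cos (\<theta> + u * T n \<omega>) \<partial>M n) - exp (- (u\<^sup>2 * v n / 2)) * cos \<theta>) \<le> e n) sequentially"
      using eventually_gt_at_top[of "2 * H"]
    proof eventually_elim
      case (elim n)
      then show ?case
        using directional_sample.integral_cos_T_St[OF smp elim, of \<theta> u]
        unfolding T_def v_def e_def by simp
    qed
    then have "(\<lambda>n. (\<integral>\<omega>. cos (\<theta> + u * T n \<omega>) \<partial>M n) - exp (- (u\<^sup>2 * v n / 2)) * cos \<theta>) \<longlonglongrightarrow> 0"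
      by (rule Lim_null_comparison[OF _ e])
    moreover have "(\<lambda>n. exp (- (u\<^sup>2 * v n / 2)) * cos \<theta>) \<longlonglongrightarrow> exp (- (u\<^sup>2 * 1 / 2)) * cos \<theta>"
      by (intro tendsto_intros v) simp
    ultimately have "(\<lambda>n. ((\<integral>\<omega>. cos (\<theta> + u * T n \<omega>) \<partial>M n) - exp (- (u\<^sup>2 * v n / 2)) * cos \<theta>)
        + exp (- (u\<^sup>2 * v n / 2)) * cos \<theta>) \<longlonglongrightarrow> 0 + exp (- (u\<^sup>2 * 1 / 2)) * cos \<theta>"
      by (rule tendsto_add)
    then show ?thesis by simp
  qed
  have char_eq: "char (distr (M n) borel (T n)) u
     = Complex (\<integral>\<omega>. cos (0 + u * T n \<omega>) \<partial>M n) (\<integral>\<omega>. cos (- (pi / 2) + u * T n \<omega>) \<partial>M n)" for n u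
  proof -
    interpret prob_space "M n" using M_prob by simp
    note mT[of n, measurable]
    have sh: "cos (x - pi / 2) = sin x" for x :: real by (simp add: cos_diff)
    have i: "integrable (M n) (\<lambda>\<omega>. iexp (u * T n \<omega>))"
      by (rule integrable_const_bound[where B=1]) auto
    have "char (distr (M n) borel (T n)) u = (\<integral>\<omega>. iexp (u * T n \<omega>) \<partial>M n)"
      unfolding char_def by (subst integral_distr) auto
    moreover have "Re (\<integral>\<omega>. iexp (u * T n \<omega>) \<partial>M n) = (\<integral>\<omega>. cos (0 + u * T n \<omega>) \<partial>M n)"
      using integral_bounded_linear[OF bounded_linear_Re i] by (simp add: Re_exp)
    moreover have "Im (\<integral>\<omega>. iexp (u * T n \<omega>) \<partial>M n) = (\<integral>\<omega>. cos (- (pi / 2) + u * T n \<omega>) \<partial>M n)"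
      using integral_bounded_linear[OF bounded_linear_Im i] by (simp add: Im_exp sh)
    ultimately show ?thesis by (simp add: complex_eq_iff)
  qed
  have "weak_conv_m (\<lambda>n. distr (M n) borel (T n)) std_normal_distribution"
  proof (rule levy_continuity)
    show "real_distribution (distr (M n) borel (T n))" for n
      using M_prob mT by (intro prob_space.real_distribution_distr) auto
    show "real_distribution std_normal_distribution" by (rule real_dist_normal_dist)
    show "(\<lambda>n. char (distr (M n) borel (T n)) u) \<longlonglongrightarrow> char std_normal_distribution u" for u
      unfolding char_eq char_std_normal_distribution tendsto_complex_iff
      using cos_lim[of 0 u] cos_lim[of "- (pi / 2)" u] by simp
  qed
  then show "weak_conv_m (\<lambda>n. distr (M n) borel (\<lambda>\<omega>. T_St H (p n) n (\<lambda>t. unit_dir (p n) (X n t \<omega>))))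
           std_normal_distribution"
    unfolding T_def .
qed

end
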